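(* Let $n\geq 4$. There does not exist a polynomial-time oracle machine that tests whether a matroid satisfies Kinser inequality $n$ (i.e. whether $M\in\mathcal{K}_n$), nor one that tests whether the dual of a matroid satisfies Kinser inequality $n$ (i.e. whether $M^*\in\mathcal{K}_n$).
   Context: All matroids are finite. For a matroid $M$ with rank function $r$ and ground set $E(M)$, and an integer $n\geq 4$, the $n$-th Kinser inequality for a family $X_1,\dots,X_n$ of subsets of $E(M)$ is $$\sum_{i=3}^n r(X_i)+r(X_1\cup X_2)+r(X_1\cup X_3\cup X_n)+\sum_{i=4}^n r(X_2\cup X_{i-1}\cup X_i)\leq r(X_1\cup X_3)+r(X_1\cup X_n)+\sum_{i=3}^n r(X_2\cup X_i)+\sum_{i=4}^n r(X_{i-1}\cup X_i).$$ $\mathcal{K}_n$ is the class of matroids $M$ that satisfy the $n$-th Kinser inequality for all families $X_1,\dots,X_n$ of subsets of $E(M)$; $M^*$ denotes the dual matroid. An oracle machine is a Turing machine equipped with a rank oracle for the input matroid $M$: the machine is given the ground set $E$, may query any subset $X\subseteq E$, and receives $r(X)$ in a single step. Each query counts as at least one step. The machine tests a property if for every input matroid it correctly decides whether the property holds; it is polynomial-time if its number of steps (in particular, its number of queries) is bounded by a polynomial in $|E|$. *)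

theory Defs
  imports "HOL-Computational_Algebra.Polynomial"
begin

section \<open>Matroids\<close>

locale matroid =
  fixes E :: "'a set" and \<I> :: "'a set set"
  assumes finite_ground: "finite E"
    and indep_subset_ground: "I \<in> \<I> \<Longrightarrow> I \<subseteq> E"
    and empty_indep: "{} \<in> \<I>"
    and indep_subset: "I \<in> \<I> \<Longrightarrow> J \<subseteq> I \<Longrightarrow> J \<in> \<I>"
    and augment: "I \<in> \<I> \<Longrightarrow> J \<in> \<I> \<Longrightarrow> card I < card J \<Longrightarrow> \<exists>x \<in> J - I. insert x I \<in> \<I>"

definition matroid_rank :: "'a set set \<Rightarrow> 'a set \<Rightarrow> nat" where
  "matroid_rank \<I> X = Max (card ` {I \<in> \<I>. I \<subseteq> X})"

definition matroid_bases :: "'a set set \<Rightarrow> 'a set set" where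
  "matroid_bases \<I> = {B \<in> \<I>. \<forall>I \<in> \<I>. B \<subseteq> I \<longrightarrow> I = B}"

text \<open>The independent sets of the matroid whose bases are the complements \<open>E - B\<close>.\<close>
definition dual_indep :: "'a set \<Rightarrow> 'a set set \<Rightarrow> 'a set set" where
  "dual_indep E \<I> = {X. \<exists>B \<in> matroid_bases \<I>. X \<subseteq> E - B}"

section \<open>Kinser inequalities\<close>

definition kinser_inequality :: "nat \<Rightarrow> ('a set \<Rightarrow> nat) \<Rightarrow> (nat \<Rightarrow> 'a set) \<Rightarrow> bool" where
  "kinser_inequality n r X \<longleftrightarrow>
     (\<Sum>i = 3..n. r (X i)) + r (X 1 \<union> X 2) + r (X 1 \<union> X 3 \<union> X n)
       + (\<Sum>i = 4..n. r (X 2 \<union> X (i - 1) \<union> X i))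
     \<le> r (X 1 \<union> X 3) + r (X 1 \<union> X n) + (\<Sum>i = 3..n. r (X 2 \<union> X i))
       + (\<Sum>i = 4..n. r (X (i - 1) \<union> X i))"

definition kinser_class :: "nat \<Rightarrow> ('a set \<times> 'a set set) set" where
  "kinser_class n = {(E, \<I>). matroid E \<I> \<and>
     (\<forall>X. (\<forall>i \<in> {1..n}. X i \<subseteq> E) \<longrightarrow> kinser_inequality n (matroid_rank \<I>) X)}"

section \<open>Turing machines with a rank oracle\<close>

text \<open>
  Deterministic multi-tape machines on two-way infinite tapes. States and tape symbols are
  initial segments of the naturals; symbol 0 is the blank and symbol 1 is the mark.
  Tape 0 is the input tape, tape 1 the query tape, tape 2 the answer tape; these three can be
  read and written freely, and any further tapes are work tapes.

  The ground set is presented to the machine through an enumeration \<open>es\<close> of its elements: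
  the input is \<open>length es\<close> in unary, and a subset is described on the query tape by
  its characteristic vector along \<open>es\<close>. One step from the query state replaces the
  answer tape by the rank of the queried set, in unary, and enters the answer state.
\<close>

datatype move = Left | Stay | Right

type_synonym tape = "(int \<Rightarrow> nat) \<times> int" \<comment> \<open>contents and head position\<close>

type_synonym config = "nat \<times> tape list"

record oracle_machine =
  num_tapes :: nat
  num_states :: nat
  num_symbols :: nat
  transition :: "nat \<Rightarrow> nat list \<Rightarrow> nat \<times> (nat \<times> move) list"
  start_state :: nat
  accept_state :: nat
  reject_state :: nat
  query_state :: nat
  answer_state :: nat

definition wf_oracle_machine :: "oracle_machine \<Rightarrow> bool" where
  "wf_oracle_machine M \<longleftrightarrow>
     3 \<le> num_tapes M \<and> 2 \<le> num_symbols M \<and>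
     {start_state M, accept_state M, reject_state M, query_state M, answer_state M}
       \<subseteq> {..<num_states M} \<and>
     distinct [accept_state M, reject_state M, query_state M] \<and>
     (\<forall>q < num_states M. \<forall>as. length as = num_tapes M \<and> set as \<subseteq> {..<num_symbols M} \<longrightarrow>
        (case transition M q as of (q', acts) \<Rightarrow>
           q' < num_states M \<and> length acts = num_tapes M \<and>
           fst ` set acts \<subseteq> {..<num_symbols M}))"

definition unary_tape :: "nat \<Rightarrow> tape" where
  "unary_tape k = ((\<lambda>j. if 0 \<le> j \<and> j < int k then 1 else 0), 0)"

definition blank_tape :: tape where
  "blank_tape = ((\<lambda>_. 0), 0)"

fun read_tape :: "tape \<Rightarrow> nat" where
  "read_tape (f, h) = f h"

fun move_head :: "move \<Rightarrow> int \<Rightarrow> int" where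
  "move_head Left h = h - 1"
| "move_head Stay h = h"
| "move_head Right h = h + 1"

fun act_tape :: "nat \<times> move \<Rightarrow> tape \<Rightarrow> tape" where
  "act_tape (a, d) (f, h) = (f(h := a), move_head d h)"

fun queried_set :: "'a list \<Rightarrow> tape \<Rightarrow> 'a set" where
  "queried_set es (f, h) = {es ! i | i. i < length es \<and> f (int i) = 1}"

definition initial_config :: "oracle_machine \<Rightarrow> nat \<Rightarrow> config" where
  "initial_config M m =
     (start_state M, unary_tape m # replicate (num_tapes M - 1) blank_tape)"

definition halted :: "oracle_machine \<Rightarrow> config \<Rightarrow> bool" where
  "halted M c \<longleftrightarrow> fst c \<in> {accept_state M, reject_state M}"

definition machine_step ::
  "oracle_machine \<Rightarrow> 'a list \<Rightarrow> ('a set \<Rightarrow> nat) \<Rightarrow> config \<Rightarrow> config" where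
  "machine_step M es r c =
     (if halted M c then c
      else if fst c = query_state M then
        (answer_state M, (snd c)[2 := unary_tape (r (queried_set es (snd c ! 1)))])
      else
        (case transition M (fst c) (map read_tape (snd c)) of (q', acts) \<Rightarrow>
           (q', map2 act_tape acts (snd c))))"

definition machine_run ::
  "oracle_machine \<Rightarrow> 'a list \<Rightarrow> ('a set \<Rightarrow> nat) \<Rightarrow> nat \<Rightarrow> config" where
  "machine_run M es r t = (machine_step M es r ^^ t) (initial_config M (length es))"

text \<open>
  The inputs are all matroids whose ground set is a finite set of naturals, under all
  enumerations of the ground set; up to relabelling these are all finite matroids.
\<close>

definition tests :: "oracle_machine \<Rightarrow> (nat set \<Rightarrow> nat set set \<Rightarrow> bool) \<Rightarrow> bool" where
  "tests M P \<longleftrightarrow>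
     (\<forall>E \<I> es. matroid E \<I> \<and> distinct es \<and> set es = E \<longrightarrow>
        (\<exists>t. fst (machine_run M es (matroid_rank \<I>) t) =
               (if P E \<I> then accept_state M else reject_state M)))"

definition polynomial_time :: "oracle_machine \<Rightarrow> bool" where
  "polynomial_time M \<longleftrightarrow>
     (\<exists>p :: nat poly. \<forall>(E :: nat set) \<I> es. matroid E \<I> \<and> distinct es \<and> set es = E \<longrightarrow>
        (\<exists>t \<le> poly p (card E). halted M (machine_run M es (matroid_rank \<I>) t)))"

end

theory Submission
  imports Defs "HOL-Library.Set_Algebras" "HOL-Library.Z2"
begin

text \<open>
  The rank-\<open>r\<close> binary spike has \<open>2 r\<close> elements, grouped into \<open>r\<close> pairs (\<^emph>\<open>legs\<close>), and over the
  field with two elements it is represented by the unit vectors \<open>e\<^sub>i\<close> together with the vectors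
  \<open>e\<^sub>i + (1, \<dots>, 1)\<close>. A transversal of the legs sums to zero exactly when it uses an odd number of
  vectors of the second kind, so there are \<open>2 ^ (r - 1)\<close> dependent transversals. Each of them is a
  circuit-hyperplane: it can be declared independent (\<^emph>\<open>relaxed\<close>) to give a new matroid whose rank
  function differs from the old one at that single set.

  The spike satisfies every Kinser inequality because it is representable. Over the two-element
  field this can be proved by counting: the subset sums of a set of vectors form a group with
  \<open>2 ^ rank\<close> elements, and \<open>|A + B| |A \<inter> B| = |A| |B|\<close> makes the dimension a modular function
  (\<open>card_plus_Int\<close>, \<open>kinser_fin_subgroups\<close>, \<open>binary_kinser\<close>). A relaxed spike of rank at least 4
  violates every Kinser inequality with \<open>n \<ge> 4\<close>: the relaxed transversal splits into two parts that, after
  contracting all but four of its elements, sit in a Vamos-like configuration of pairs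
  in which five unions of two pairs are dependent and the sixth is not
  (\<open>relaxed_spike_violates_kinser\<close>). This refutes the inequality for \<open>n = 4\<close>, and repeating the last
  set carries the refutation to every larger \<open>n\<close>.

  A machine that makes polynomially many queries on the spike misses one of the exponentially many
  dependent transversals, so it behaves in the same way on the matroid that relaxes this
  transversal, and one of the two answers is wrong (\<open>no_polynomial_time_test\<close>).

  For the dual property the same matroids serve. If \<open>r\<close> is even, the complement of a basis of the
  spike is again a basis, so the spike is its own dual, and the dual of the relaxation of a
  transversal is the relaxation of the complementary transversal (\<open>dual_spike\<close>).
\<close>

section \<open>Kinser inequalities for finite subgroups\<close>

definition fin_subgroup :: "'g::ab_group_add set \<Rightarrow> bool" where
  "fin_subgroup A \<longleftrightarrow> finite A \<and> 0 \<in> A \<and> (\<forall>a \<in> A. \<forall>b \<in> A. a - b \<in> A)"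

lemma fin_subgroup_add:
  assumes "fin_subgroup A" "a \<in> A" "b \<in> A"
  shows "a + b \<in> A"
proof -
  have "0 - b \<in> A" using assms unfolding fin_subgroup_def by blast
  then have "a - (0 - b) \<in> A" using assms unfolding fin_subgroup_def by blast
  then show ?thesis by simp
qed

lemma fin_subgroup_Int: "fin_subgroup A \<Longrightarrow> fin_subgroup B \<Longrightarrow> fin_subgroup (A \<inter> B)"
  by (auto simp: fin_subgroup_def)

lemma fin_subgroup_plus:
  assumes "fin_subgroup A" "fin_subgroup B"
  shows "fin_subgroup (A + B)"
proof -
  have "x - y \<in> A + B" if xy: "x \<in> A + B" "y \<in> A + B" for x y
  proof -
    obtain a b c d where "x = a + b" "y = c + d" "a \<in> A" "b \<in> B" "c \<in> A" "d \<in> B"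
      using xy by (fastforce elim!: set_plus_elim)
    then have "x - y = (a - c) + (b - d)" "a - c \<in> A" "b - d \<in> B"
      using assms by (auto simp: fin_subgroup_def)
    then show ?thesis by auto
  qed
  moreover have "0 + 0 \<in> A + B" using assms unfolding fin_subgroup_def by blast
  ultimately show ?thesis using assms by (auto simp: fin_subgroup_def intro: finite_set_plus)
qed

lemma plus_subset_fin_subgroup:
  assumes "fin_subgroup C" "A \<subseteq> C" "B \<subseteq> C"
  shows "A + B \<subseteq> C"
  using assms fin_subgroup_add by (fastforce elim!: set_plus_elim)

lemma subset_plus_fin_subgroup:
  assumes "fin_subgroup A" "fin_subgroup B"
  shows "A \<subseteq> A + B" "B \<subseteq> A + B"
proof -
  have "a + 0 \<in> A + B" if "a \<in> A" for a using that assms unfolding fin_subgroup_def by blast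
  then show "A \<subseteq> A + B" by auto
  have "0 + b \<in> A + B" if "b \<in> B" for b using that assms unfolding fin_subgroup_def by blast
  then show "B \<subseteq> A + B" by auto
qed

text \<open>
  The map \<open>(a, b) \<mapsto> a + b\<close> from \<open>A \<times> B\<close> onto \<open>A + B\<close> has fibres in bijection with \<open>A \<inter> B\<close>; the proof
  turns a choice \<open>g\<close> of one \<open>A\<close>-component for each sum into a bijection
  \<open>(A + B) \<times> (A \<inter> B) \<rightarrow> A \<times> B\<close>.
\<close>

lemma card_plus_Int:
  assumes A: "fin_subgroup A" and B: "fin_subgroup B"
  shows "card (A + B) * card (A \<inter> B) = card A * card B"
proof -
  have "\<forall>s \<in> A + B. \<exists>a. a \<in> A \<and> s - a \<in> B" by (force elim!: set_plus_elim)
  then obtain g where g: "\<And>s. s \<in> A + B \<Longrightarrow> g s \<in> A \<and> s - g s \<in> B" by metis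
  have diff: "x - y \<in> C" if "fin_subgroup C" "x \<in> C" "y \<in> C" for x y :: 'a and C
    using that by (auto simp: fin_subgroup_def)
  have "bij_betw (\<lambda>(s, t). (g s + t, s - g s - t)) ((A + B) \<times> (A \<inter> B)) (A \<times> B)"
  proof (rule bij_betw_byWitness[where f' = "\<lambda>(a, b). (a + b, a - g (a + b))"])
    show "(\<lambda>(s, t). (g s + t, s - g s - t)) ` ((A + B) \<times> (A \<inter> B)) \<subseteq> A \<times> B"
      using g fin_subgroup_add[OF A] diff[OF B] by auto
    have "a - g (a + b) \<in> A \<inter> B" if "a \<in> A" "b \<in> B" for a b
    proof -
      have *: "g (a + b) \<in> A" "a + b - g (a + b) \<in> B" using g that by auto
      then have "a + b - g (a + b) - b \<in> B" using that diff[OF B] by blast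
      then show ?thesis using diff[OF A that(1) *(1)] by (simp add: algebra_simps)
    qed
    then show "(\<lambda>(a, b). (a + b, a - g (a + b))) ` (A \<times> B) \<subseteq> (A + B) \<times> (A \<inter> B)" by auto
  qed auto
  from bij_betw_same_card[OF this] show ?thesis by (simp add: card_cartesian_product)
qed

text \<open>
  For a vector space over the two-element field this is the dimension.
\<close>

definition ldim :: "'g set \<Rightarrow> real" where
  "ldim A = log 2 (card A)"

lemma card_pos: "fin_subgroup A \<Longrightarrow> 0 < card A"
  by (auto simp: fin_subgroup_def card_gt_0_iff)

lemma ldim_modular:
  assumes "fin_subgroup A" "fin_subgroup B"
  shows "ldim (A + B) + ldim (A \<inter> B) = ldim A + ldim B"
proof -
  have pos: "0 < card A" "0 < card B" "0 < card (A + B)" "0 < card (A \<inter> B)"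
    using assms by (auto intro: card_pos fin_subgroup_plus fin_subgroup_Int)
  have "log 2 (real (card (A + B)) * real (card (A \<inter> B))) = log 2 (real (card A) * real (card B))"
    using card_plus_Int[OF assms] by (metis of_nat_mult)
  then show ?thesis using pos by (simp add: ldim_def log_mult)
qed

lemma ldim_mono:
  assumes "fin_subgroup A" "fin_subgroup B" "A \<subseteq> B"
  shows "ldim A \<le> ldim B"
proof -
  have "card A \<le> card B" using assms by (auto simp: fin_subgroup_def intro: card_mono)
  then show ?thesis using card_pos[OF assms(1)] by (simp add: ldim_def)
qed

text \<open>
  Two applications of modularity to the pairs \<open>(A, W)\<close> and \<open>(B, W)\<close>, one to \<open>(A + B, W)\<close>, and the
  inclusion \<open>(A \<inter> W) + (B \<inter> W) \<subseteq> (A + B) \<inter> W\<close>. In the language of mutual information it bounds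
  \<open>I(A; B) - I(A; B | W)\<close> by the dimension of \<open>A \<inter> B \<inter> W\<close>. This is the point where
  representability enters, since a general matroid has no flat playing the role of an intersection.
\<close>

lemma ldim_triple:
  assumes A: "fin_subgroup A" and B: "fin_subgroup B" and W: "fin_subgroup W"
  shows "ldim B + ldim (W + A + B) + ldim (A \<inter> W)
    \<le> ldim (W + B) + ldim (A + B) + ldim ((A \<inter> W) \<inter> (B \<inter> W))"
proof -
  have "(A \<inter> W) + (B \<inter> W) \<subseteq> (A + B) \<inter> W"
    using fin_subgroup_add[OF W] by (auto elim!: set_plus_elim)
  then have "ldim ((A \<inter> W) + (B \<inter> W)) \<le> ldim ((A + B) \<inter> W)"
    using assms by (intro ldim_mono fin_subgroup_Int fin_subgroup_plus) auto
  moreover have "ldim ((A \<inter> W) + (B \<inter> W)) + ldim ((A \<inter> W) \<inter> (B \<inter> W)) = ldim (A \<inter> W) + ldim (B \<inter> W)"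
    using assms by (intro ldim_modular fin_subgroup_Int)
  moreover have "ldim ((A + B) + W) + ldim ((A + B) \<inter> W) = ldim (A + B) + ldim W"
    using assms by (intro ldim_modular fin_subgroup_plus)
  moreover have "(A + B) + W = W + A + B" by (simp add: ac_simps)
  moreover have "ldim (B + W) + ldim (B \<inter> W) = ldim B + ldim W" using B W by (rule ldim_modular)
  moreover have "B + W = W + B" by (simp add: ac_simps)
  ultimately show ?thesis by simp
qed

lemma ldim_chain:
  assumes P: "fin_subgroup P" and Q: "fin_subgroup Q" and R: "fin_subgroup R"
  shows "ldim (P \<inter> Q) + ldim (Q \<inter> R) \<le> ldim Q + ldim (P \<inter> R)"
proof -
  have "ldim (P \<inter> Q) + ldim (Q \<inter> R) = ldim ((P \<inter> Q) + (Q \<inter> R)) + ldim ((P \<inter> Q) \<inter> (Q \<inter> R))"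
    using assms by (intro ldim_modular[symmetric] fin_subgroup_Int)
  moreover have "ldim ((P \<inter> Q) + (Q \<inter> R)) \<le> ldim Q"
    using assms
    by (intro ldim_mono plus_subset_fin_subgroup fin_subgroup_plus fin_subgroup_Int) auto
  moreover have "ldim ((P \<inter> Q) \<inter> (Q \<inter> R)) \<le> ldim (P \<inter> R)"
    using assms by (intro ldim_mono fin_subgroup_Int) auto
  ultimately show ?thesis by simp
qed

text \<open>
  Put \<open>U i = V i \<inter> V 2\<close>. Growing the chain \<open>3, 4, \<dots>, n\<close> one index at a time shows that
  the terms without \<open>V 1\<close> satisfy the inequality up to the error \<open>ldim (U 3 \<inter> U n) - ldim (V 2)\<close>; for
  the one-element chain this is an equality. The error is then absorbed by the terms with \<open>V 1\<close>,
  because \<open>U 3 \<inter> U n\<close> lies both in \<open>V 2\<close> and in \<open>(V 1 + V 3) \<inter> (V 1 + V n)\<close>.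
\<close>

lemma kinser_fin_subgroups:
  fixes V :: "nat \<Rightarrow> 'g::ab_group_add set"
  assumes V: "\<And>i. fin_subgroup (V i)" and n: "3 \<le> n"
  shows "(\<Sum>i = 3..n. ldim (V i)) + ldim (V 1 + V 2) + ldim (V 1 + V 3 + V n)
       + (\<Sum>i = 4..n. ldim (V 2 + V (i - 1) + V i))
     \<le> ldim (V 1 + V 3) + ldim (V 1 + V n) + (\<Sum>i = 3..n. ldim (V 2 + V i))
       + (\<Sum>i = 4..n. ldim (V (i - 1) + V i))"
proof -
  define U where "U i = V i \<inter> V 2" for i
  have U: "fin_subgroup (U i)" for i unfolding U_def using V by (intro fin_subgroup_Int)
  have chain: "(\<Sum>i = 3..n. ldim (V i)) + (\<Sum>i = 4..n. ldim (V 2 + V (i - 1) + V i)) + ldim (V 2)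
      \<le> (\<Sum>i = 3..n. ldim (V 2 + V i)) + (\<Sum>i = 4..n. ldim (V (i - 1) + V i)) + ldim (U 3 \<inter> U n)"
    using n
  proof (induction n rule: dec_induct)
    case base
    have "ldim (V 2 + V 3) + ldim (V 2 \<inter> V 3) = ldim (V 2) + ldim (V 3)"
      using V by (intro ldim_modular)
    then show ?case by (simp add: U_def Int_commute)
  next
    case (step m)
    have s: "(\<Sum>i = k..Suc m. f i) = (\<Sum>i = k..m. f i) + f (Suc m)" if "k \<le> Suc m"
      for k and f :: "nat \<Rightarrow> real"
      using that by simp
    have k: "3 \<le> Suc m" "4 \<le> Suc m" using step.hyps by simp_all
    have "ldim (V (Suc m)) + ldim (V 2 + V m + V (Suc m)) + ldim (U m)
        \<le> ldim (V 2 + V (Suc m)) + ldim (V m + V (Suc m)) + ldim (U m \<inter> U (Suc m))"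
      unfolding U_def using V by (intro ldim_triple)
    moreover have "ldim (U 3 \<inter> U m) + ldim (U m \<inter> U (Suc m)) \<le> ldim (U m) + ldim (U 3 \<inter> U (Suc m))"
      using U by (intro ldim_chain)
    ultimately show ?case using step.IH unfolding s[OF k(1)] s[OF k(2)] diff_Suc_1 by linarith
  qed
  define T where "T = U 3 \<inter> U n"
  have T: "fin_subgroup T" unfolding T_def using U by (intro fin_subgroup_Int)
  have "ldim (V 1 + V 2) + ldim (V 1 + V 3 + V n) + ldim T
      \<le> ldim (V 1 + V 3) + ldim (V 1 + V n) + ldim (V 2)"
  proof -
    have V1: "V 1 + V 1 = V 1"
      using V by (intro equalityI plus_subset_fin_subgroup subset_plus_fin_subgroup) auto
    have "(V 1 + V 3) + (V 1 + V n) = (V 1 + V 1) + V 3 + V n" by (simp only: ac_simps)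
    then have e: "(V 1 + V 3) + (V 1 + V n) = V 1 + V 3 + V n" by (simp only: V1)
    have "ldim ((V 1 + V 3) + (V 1 + V n)) + ldim ((V 1 + V 3) \<inter> (V 1 + V n))
        = ldim (V 1 + V 3) + ldim (V 1 + V n)"
      using V by (intro ldim_modular fin_subgroup_plus)
    moreover have "ldim (V 1 + V 2) + ldim (V 1 \<inter> V 2) = ldim (V 1) + ldim (V 2)"
      using V by (intro ldim_modular)
    moreover have "ldim (V 1 + T) + ldim (V 1 \<inter> T) = ldim (V 1) + ldim T"
      using V T by (intro ldim_modular)
    moreover have "ldim (V 1 \<inter> T) \<le> ldim (V 1 \<inter> V 2)"
      using V T by (intro ldim_mono fin_subgroup_Int) (auto simp: T_def U_def)
    moreover have "ldim (V 1 + T) \<le> ldim ((V 1 + V 3) \<inter> (V 1 + V n))"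
      using V T by (intro ldim_mono fin_subgroup_Int fin_subgroup_plus)
        (auto simp: T_def U_def elim!: set_plus_elim)
    ultimately show ?thesis unfolding e by linarith
  qed
  with chain show ?thesis by (simp add: T_def)
qed

section \<open>Ranks, bases and relaxations of matroids\<close>

context matroid
begin

lemma finite_indep_subsets: "finite {I \<in> \<I>. I \<subseteq> X}"
proof (rule finite_subset)
  show "{I \<in> \<I>. I \<subseteq> X} \<subseteq> Pow E" by (blast dest: indep_subset_ground)
qed (simp add: finite_ground)

lemma finite_indep: "I \<in> \<I> \<Longrightarrow> finite I"
  by (rule finite_subset[OF indep_subset_ground finite_ground])

lemma card_le_rank: "I \<in> \<I> \<Longrightarrow> I \<subseteq> X \<Longrightarrow> card I \<le> matroid_rank \<I> X"
  unfolding matroid_rank_def using finite_indep_subsets by (intro Max_ge) auto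

lemma rank_attained: "\<exists>I \<in> \<I>. I \<subseteq> X \<and> card I = matroid_rank \<I> X"
proof -
  have "Max (card ` {I \<in> \<I>. I \<subseteq> X}) \<in> card ` {I \<in> \<I>. I \<subseteq> X}"
    using finite_indep_subsets empty_indep by (intro Max_in) auto
  then show ?thesis unfolding matroid_rank_def by auto
qed

lemma rank_le:
  assumes "\<And>I. I \<in> \<I> \<Longrightarrow> I \<subseteq> X \<Longrightarrow> card I \<le> k"
  shows "matroid_rank \<I> X \<le> k"
proof -
  obtain I where "I \<in> \<I>" "I \<subseteq> X" "card I = matroid_rank \<I> X" using rank_attained[of X] by blast
  then show ?thesis using assms[of I] by simp
qed

lemma bases_of_rank:
  assumes "B\<^sub>0 \<in> \<I>" and bound: "\<And>I. I \<in> \<I> \<Longrightarrow> card I \<le> card B\<^sub>0"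
  shows "matroid_bases \<I> = {B \<in> \<I>. card B = card B\<^sub>0}"
proof (intro equalityI subsetI)
  fix B assume B: "B \<in> matroid_bases \<I>"
  then have "B \<in> \<I>" and max: "\<And>I. I \<in> \<I> \<Longrightarrow> B \<subseteq> I \<Longrightarrow> I = B" by (auto simp: matroid_bases_def)
  moreover have "\<not> card B < card B\<^sub>0"
  proof
    assume "card B < card B\<^sub>0"
    then obtain x where "x \<in> B\<^sub>0 - B" "insert x B \<in> \<I>" using augment[OF \<open>B \<in> \<I>\<close> assms(1)] by blast
    then show False using max[of "insert x B"] by blast
  qed
  ultimately show "B \<in> {B \<in> \<I>. card B = card B\<^sub>0}" using bound[of B] by simp
next
  fix B assume B: "B \<in> {B \<in> \<I>. card B = card B\<^sub>0}"
  have "I = B" if "I \<in> \<I>" "B \<subseteq> I" for I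
    using that B bound[of I] card_seteq[of I B] finite_indep by simp
  then show "B \<in> matroid_bases \<I>" using B by (auto simp: matroid_bases_def)
qed

lemma extend_to_base:
  assumes "I \<in> \<I>" "B\<^sub>0 \<in> \<I>" "card I \<le> card B\<^sub>0"
  shows "\<exists>B \<in> \<I>. I \<subseteq> B \<and> card B = card B\<^sub>0"
  using assms
proof (induction "card B\<^sub>0 - card I" arbitrary: I)
  case 0
  then show ?case by auto
next
  case (Suc d)
  then have "card I < card B\<^sub>0" by simp
  then obtain x where x: "x \<in> B\<^sub>0 - I" "insert x I \<in> \<I>"
    using augment[OF Suc.prems(1,2)] by blast
  moreover have "card (insert x I) = Suc (card I)" using x Suc.prems finite_indep by simp
  ultimately have "\<exists>B \<in> \<I>. insert x I \<subseteq> B \<and> card B = card B\<^sub>0"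
    using Suc by (intro Suc.hyps(1)) auto
  then show ?case by auto
qed

end

text \<open>
  A circuit-hyperplane, described by independent sets only: replacing any element of \<open>H\<close> by an element
  outside \<open>H\<close> gives a basis. That \<open>H\<close> is a circuit and a hyperplane follows from this.
\<close>

locale circuit_hyperplane = matroid +
  fixes H
  assumes H_proper: "H \<subset> E" and H_dep: "H \<notin> \<I>"
    and exchange: "e \<in> E - H \<Longrightarrow> x \<in> H \<Longrightarrow> insert e (H - {x}) \<in> \<I>"
    and card_le: "I \<in> \<I> \<Longrightarrow> card I \<le> card H"
begin

lemma finite_H: "finite H"
  using H_proper finite_subset[OF _ finite_ground] by blast

lemma psubset_indep:
  assumes "J \<subset> H"
  shows "J \<in> \<I>"
proof -
  obtain x where "x \<in> H" "x \<notin> J" using assms by blast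
  moreover obtain e where "e \<in> E - H" using H_proper by blast
  ultimately show ?thesis using indep_subset[OF exchange[of e x], of J] assms by blast
qed

lemma card_exchange: "e \<in> E - H \<Longrightarrow> x \<in> H \<Longrightarrow> card (insert e (H - {x})) = card H"
  using card.remove[OF finite_H, of x] finite_H by (simp del: card_Diff_insert)

lemma H_nonempty: "H \<noteq> {}"
  using H_dep empty_indep by auto

text \<open>
  The only new instances of augmentation are those towards \<open>H\<close>. A smaller independent set \<open>I\<close> inside
  \<open>H\<close> is enlarged within \<open>H\<close>. Otherwise \<open>I\<close> contains some \<open>e\<close> outside \<open>H\<close>, and augmenting it from the
  basis \<open>insert e (H - {x})\<close> adds an element of \<open>H\<close>, since \<open>e\<close> is already present.
\<close>

lemma matroid_relaxation: "matroid E (insert H \<I>)"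
proof
  fix I J assume I: "I \<in> insert H \<I>" and J: "J \<in> insert H \<I>" and less: "card I < card J"
  have "I \<in> \<I>" using I J less card_le[of J] by auto
  show "\<exists>x \<in> J - I. insert x I \<in> insert H \<I>"
  proof (cases "J \<in> \<I>")
    case True
    then show ?thesis using augment[OF \<open>I \<in> \<I>\<close> True less] by blast
  next
    case False
    then have "J = H" using J by simp
    show ?thesis
    proof (cases "I \<subseteq> H")
      case True
      moreover have "I \<noteq> H" using less \<open>J = H\<close> by blast
      ultimately obtain x where "x \<in> H - I" by blast
      then show ?thesis using psubset_indep[of "insert x I"] True \<open>J = H\<close> by blast
    next
      case False
      then obtain e where e: "e \<in> I" "e \<in> E - H" using indep_subset_ground[OF \<open>I \<in> \<I>\<close>] by blast
      obtain x where x: "x \<in> H" using H_nonempty by blast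
      have "card I < card (insert e (H - {x}))" using less e x \<open>J = H\<close> by (simp only: card_exchange)
      then show ?thesis
        using augment[OF \<open>I \<in> \<I>\<close> exchange[OF e(2) x]] e \<open>J = H\<close> by blast
    qed
  qed
next
  fix I J assume "I \<in> insert H \<I>" "J \<subseteq> I"
  then show "J \<in> insert H \<I>" using psubset_indep[of J] indep_subset[of I J] by blast
next
  fix I assume "I \<in> insert H \<I>"
  then show "I \<subseteq> E" using H_proper indep_subset_ground[of I] by blast
qed (simp_all add: finite_ground empty_indep)

text \<open>
  A set that properly contains \<open>H\<close> already contains a basis \<open>insert e (H - {x})\<close>, and a set
  that does not contain \<open>H\<close> has the same independent subsets as before.
\<close>

lemma rank_relaxation:
  assumes "X \<subseteq> E" "X \<noteq> H"
  shows "matroid_rank (insert H \<I>) X = matroid_rank \<I> X"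
proof (cases "H \<subseteq> X")
  case False
  then have "{I \<in> insert H \<I>. I \<subseteq> X} = {I \<in> \<I>. I \<subseteq> X}" by auto
  then show ?thesis by (simp add: matroid_rank_def)
next
  case True
  interpret R: matroid E "insert H \<I>" by (rule matroid_relaxation)
  obtain e where e: "e \<in> X" "e \<in> E - H" using True assms by blast
  obtain x where x: "x \<in> H" using H_nonempty by blast
  have "card H \<le> matroid_rank \<I> X"
    using card_le_rank[OF exchange[OF e(2) x], of X] True e(1) card_exchange[OF e(2) x] by auto
  then have "card I \<le> matroid_rank \<I> X" if "I \<in> insert H \<I>" "I \<subseteq> X" for I
    using that card_le_rank[of I X] by blast
  then have "matroid_rank (insert H \<I>) X \<le> matroid_rank \<I> X" by (rule R.rank_le)
  moreover have "matroid_rank \<I> X \<le> matroid_rank (insert H \<I>) X"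
    by (intro rank_le R.card_le_rank) auto
  ultimately show ?thesis by simp
qed

text \<open>
  If complements of bases are bases, a matroid equals its dual, and the new basis \<open>H\<close> of the relaxation
  contributes only its complement to the dual, all proper subsets of which are assumed independent.
\<close>

lemma dual_indep_relaxation:
  assumes compl: "\<And>B. B \<in> \<I> \<Longrightarrow> card B = card H \<Longrightarrow> E - B \<in> \<I>"
    and half: "card E = 2 * card H"
    and dual: "\<And>J. J \<subset> E - H \<Longrightarrow> J \<in> \<I>"
  shows "dual_indep E \<I> = \<I>" "dual_indep E (insert H \<I>) = insert (E - H) \<I>"
proof -
  interpret R: matroid E "insert H \<I>" by (rule matroid_relaxation)
  obtain e x where ex: "e \<in> E - H" "x \<in> H" using H_nonempty H_proper by blast
  define B\<^sub>0 where "B\<^sub>0 = insert e (H - {x})"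
  have B\<^sub>0: "B\<^sub>0 \<in> \<I>" "card B\<^sub>0 = card H"
    unfolding B\<^sub>0_def using exchange[OF ex] card_exchange[OF ex] by auto
  have bases: "matroid_bases \<I> = {B \<in> \<I>. card B = card H}"
    using bases_of_rank[OF B\<^sub>0(1)] unfolding B\<^sub>0(2) by (simp add: card_le)
  have bases': "matroid_bases (insert H \<I>) = {B \<in> insert H \<I>. card B = card H}"
  proof (rule R.bases_of_rank)
    fix I assume "I \<in> insert H \<I>"
    then show "card I \<le> card H" using card_le[of I] by auto
  qed simp
  have up: "\<exists>B \<in> \<I>. card B = card H \<and> I \<subseteq> E - B" if I: "I \<in> \<I>" for I
  proof -
    obtain B where B: "B \<in> \<I>" "I \<subseteq> B" "card B = card H"
      using extend_to_base[OF I B\<^sub>0(1)] card_le[OF I] unfolding B\<^sub>0(2) by blast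
    have "B \<subseteq> E" using B(1) by (rule indep_subset_ground)
    then have "card (E - B) = card H" "I \<subseteq> E - (E - B)"
      using B half finite_indep[OF B(1)] by (auto simp: card_Diff_subset)
    with compl[OF B(1,3)] show ?thesis by (intro bexI[of _ "E - B"] conjI)
  qed
  have down: "I \<in> \<I>" if "B \<in> \<I>" "card B = card H" "I \<subseteq> E - B" for I B
    using indep_subset[OF compl[OF that(1,2)] that(3)] .
  show "dual_indep E \<I> = \<I>"
  proof (intro equalityI subsetI)
    fix I assume "I \<in> dual_indep E \<I>"
    then obtain B where "B \<in> \<I>" "card B = card H" "I \<subseteq> E - B"
      unfolding dual_indep_def bases by auto
    then show "I \<in> \<I>" by (rule down)
  next
    fix I assume "I \<in> \<I>"
    from up[OF this] show "I \<in> dual_indep E \<I>" unfolding dual_indep_def bases by auto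
  qed
  show "dual_indep E (insert H \<I>) = insert (E - H) \<I>"
  proof (intro equalityI subsetI)
    fix I assume "I \<in> dual_indep E (insert H \<I>)"
    then obtain B where B: "B \<in> insert H \<I>" "card B = card H" "I \<subseteq> E - B"
      unfolding dual_indep_def bases' by auto
    show "I \<in> insert (E - H) \<I>"
    proof (cases "B = H")
      case True
      then show ?thesis using B(3) dual[of I] by auto
    next
      case False
      then show ?thesis using B down[of B I] by simp
    qed
  next
    fix I assume "I \<in> insert (E - H) \<I>"
    then consider "I = E - H" | "I \<in> \<I>" by blast
    then show "I \<in> dual_indep E (insert H \<I>)"
    proof cases
      case 1
      then show ?thesis unfolding dual_indep_def bases' by (auto intro!: exI[of _ H])
    next
      case 2
      from up[OF this] show ?thesis unfolding dual_indep_def bases' by auto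
    qed
  qed
qed

end

section \<open>Binary matroids\<close>

text \<open>
  Linear independence over the two-element field: the only linear combinations are subset sums.
\<close>

definition binary_indep :: "('a \<Rightarrow> 'g::ab_group_add) \<Rightarrow> 'a set \<Rightarrow> 'a set set" where
  "binary_indep v E = {I. I \<subseteq> E \<and> (\<forall>Y \<subseteq> I. sum v Y = 0 \<longrightarrow> Y = {})}"

text \<open>
  The linear span over the two-element field.
\<close>

definition subset_sums :: "('a \<Rightarrow> 'g::ab_group_add) \<Rightarrow> 'a set \<Rightarrow> 'g set" where
  "subset_sums v X = sum v ` Pow X"

locale binary_vectors =
  fixes v :: "'a \<Rightarrow> 'g::ab_group_add" and E :: "'a set"
  assumes char_two: "(g :: 'g) + g = 0" and finite_E: "finite E"
begin

lemma finite_sub: "X \<subseteq> E \<Longrightarrow> finite X"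
  by (rule finite_subset[OF _ finite_E])

lemma minus_eq: "(g :: 'g) - h = g + h"
proof -
  have "- h = h" using char_two[of h] by (rule add.inverse_unique)
  then show ?thesis by (simp only: diff_conv_add_uminus)
qed

lemma sum_sym_diff:
  assumes "finite P" "finite Q"
  shows "sum v P + sum v Q = sum v ((P - Q) \<union> (Q - P))"
proof -
  have "sum v P = sum v (P \<inter> Q) + sum v (P - Q)" using assms by (intro sum.Int_Diff)
  moreover have "sum v Q = sum v (Q \<inter> P) + sum v (Q - P)" using assms by (intro sum.Int_Diff)
  moreover have "sum v ((P - Q) \<union> (Q - P)) = sum v (P - Q) + sum v (Q - P)"
    using assms by (intro sum.union_disjoint) auto
  moreover have "(c + a) + (c + b) = a + b" for a b c :: 'g
  proof -
    have "(c + a) + (c + b) = (c + c) + (a + b)" by (simp only: ac_simps)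
    then show ?thesis by (simp add: char_two)
  qed
  ultimately show ?thesis by (simp add: Int_commute)
qed

lemma fin_subgroup_subset_sums:
  assumes "X \<subseteq> E"
  shows "fin_subgroup (subset_sums v X)"
proof -
  have "finite X" using assms by (rule finite_sub)
  have "sum v P - sum v Q \<in> subset_sums v X" if "P \<subseteq> X" "Q \<subseteq> X" for P Q
  proof -
    have "sum v P - sum v Q = sum v ((P - Q) \<union> (Q - P))"
      unfolding minus_eq using that \<open>finite X\<close> finite_subset by (blast intro: sum_sym_diff)
    then show ?thesis using that by (auto simp: subset_sums_def)
  qed
  moreover have "0 \<in> subset_sums v X" unfolding subset_sums_def by (rule image_eqI[of _ _ "{}"]) auto
  ultimately show ?thesis using \<open>finite X\<close> unfolding fin_subgroup_def by (auto simp: subset_sums_def)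
qed

lemma subset_sums_Un:
  assumes "X \<subseteq> E" "Y \<subseteq> E"
  shows "subset_sums v (X \<union> Y) = subset_sums v X + subset_sums v Y"
proof
  show "subset_sums v X + subset_sums v Y \<subseteq> subset_sums v (X \<union> Y)"
    using assms by (intro plus_subset_fin_subgroup fin_subgroup_subset_sums) (auto simp: subset_sums_def)
  show "subset_sums v (X \<union> Y) \<subseteq> subset_sums v X + subset_sums v Y"
  proof
    fix g assume "g \<in> subset_sums v (X \<union> Y)"
    then obtain P where P: "P \<subseteq> X \<union> Y" "g = sum v P" by (auto simp: subset_sums_def)
    have "g = sum v (P \<inter> X) + sum v (P - X)"
      unfolding P(2) using P(1) assms by (intro sum.Int_Diff finite_sub) auto
    then show "g \<in> subset_sums v X + subset_sums v Y"
      using P by (auto simp: subset_sums_def)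
  qed
qed

text \<open>
  Subsets of an independent set with equal sums have a symmetric difference with sum zero, so distinct
  subsets have distinct sums.
\<close>

lemma card_subset_sums_indep:
  assumes "I \<in> binary_indep v E"
  shows "card (subset_sums v I) = 2 ^ card I"
proof -
  have I: "I \<subseteq> E" "\<And>Y. Y \<subseteq> I \<Longrightarrow> sum v Y = 0 \<Longrightarrow> Y = {}" using assms by (auto simp: binary_indep_def)
  have fI: "finite I" using I(1) by (rule finite_sub)
  have "inj_on (sum v) (Pow I)"
  proof (rule inj_onI)
    fix P Q assume PQ: "P \<in> Pow I" "Q \<in> Pow I" and eq: "sum v P = sum v Q"
    have "sum v ((P - Q) \<union> (Q - P)) = sum v P + sum v Q"
      using PQ fI finite_subset by (intro sum_sym_diff[symmetric]) auto
    also have "\<dots> = 0" using eq by (simp add: char_two)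
    finally have "(P - Q) \<union> (Q - P) = {}" using PQ by (intro I(2)) auto
    then show "P = Q" by blast
  qed
  then show ?thesis by (simp add: subset_sums_def card_image card_Pow fI)
qed

lemma in_subset_sums_of_dependent:
  assumes I: "I \<in> binary_indep v E" and x: "x \<in> E" and dep: "insert x I \<notin> binary_indep v E"
  shows "v x \<in> subset_sums v I"
proof -
  obtain Y where Y: "Y \<subseteq> insert x I" "sum v Y = 0" "Y \<noteq> {}"
    using assms by (auto simp: binary_indep_def)
  have "x \<in> Y" using Y I by (auto simp: binary_indep_def)
  moreover have "finite Y" using Y(1) I x by (intro finite_sub) (auto simp: binary_indep_def)
  ultimately have "v x + sum v (Y - {x}) = 0" using Y(2) by (simp add: sum.remove)
  then have "v x = sum v (Y - {x})" using minus_eq by (metis eq_iff_diff_eq_0)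
  then show ?thesis using Y(1) by (auto simp: subset_sums_def)
qed

lemma subset_sums_subset:
  assumes I: "I \<subseteq> E" and X: "X \<subseteq> E" and "\<And>x. x \<in> X \<Longrightarrow> v x \<in> subset_sums v I"
  shows "subset_sums v X \<subseteq> subset_sums v I"
proof -
  note G = fin_subgroup_subset_sums[OF I]
  have "sum v P \<in> subset_sums v I" if "P \<subseteq> X" for P
    using finite_sub[OF order_trans[OF that X]] that
  proof (induction P rule: finite_induct)
    case empty
    then show ?case using G by (simp add: fin_subgroup_def)
  next
    case (insert x P)
    then show ?case using assms(3) fin_subgroup_add[OF G] by simp
  qed
  then show ?thesis by (auto simp: subset_sums_def)
qed

text \<open>
  If no element of \<open>J\<close> could be added to \<open>I\<close>, the span of \<open>J\<close> would lie in the span of \<open>I\<close>, and counting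
  both spans would give \<open>2 ^ card J \<le> 2 ^ card I\<close>.
\<close>

sublocale matroid E "binary_indep v E"
proof
  fix I J assume I: "I \<in> binary_indep v E" and J: "J \<in> binary_indep v E" and less: "card I < card J"
  show "\<exists>x \<in> J - I. insert x I \<in> binary_indep v E"
  proof (rule ccontr)
    assume no: "\<not> ?thesis"
    have sub: "I \<subseteq> E" "J \<subseteq> E" using I J by (auto simp: binary_indep_def)
    have "v x \<in> subset_sums v I" if "x \<in> J" for x
    proof (cases "x \<in> I")
      case True
      then have "sum v {x} \<in> subset_sums v I" unfolding subset_sums_def by blast
      then show ?thesis by simp
    next
      case False
      then show ?thesis using no that sub I by (intro in_subset_sums_of_dependent) auto
    qed
    then have "subset_sums v J \<subseteq> subset_sums v I" using sub by (intro subset_sums_subset)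
    then have "card (subset_sums v J) \<le> card (subset_sums v I)"
      using sub finite_sub by (intro card_mono) (auto simp: subset_sums_def)
    then show False using less by (simp add: card_subset_sums_indep I J)
  qed
qed (auto simp: binary_indep_def finite_E)

text \<open>
  A largest independent subset of \<open>X\<close> has the same span as \<open>X\<close>.
\<close>

lemma ldim_subset_sums:
  assumes X: "X \<subseteq> E"
  shows "ldim (subset_sums v X) = real (matroid_rank (binary_indep v E) X)"
proof -
  obtain I where I: "I \<in> binary_indep v E" "I \<subseteq> X" "card I = matroid_rank (binary_indep v E) X"
    using rank_attained by blast
  have "v x \<in> subset_sums v I" if "x \<in> X" for x
  proof (cases "x \<in> I")
    case True
    then have "sum v {x} \<in> subset_sums v I" unfolding subset_sums_def by blast
    then show ?thesis by simp
  next
    case False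
    then have "card (insert x I) = Suc (card I)" using finite_sub I(2) X by (simp add: finite_subset)
    then have "insert x I \<notin> binary_indep v E"
      using card_le_rank[of "insert x I" X] I that by auto
    then show ?thesis using that I X by (intro in_subset_sums_of_dependent) auto
  qed
  then have "subset_sums v X \<subseteq> subset_sums v I" using I X by (intro subset_sums_subset) auto
  moreover have "subset_sums v I \<subseteq> subset_sums v X" using I(2) by (auto simp: subset_sums_def)
  ultimately have "card (subset_sums v X) = 2 ^ card I"
    using card_subset_sums_indep[OF I(1)] by simp
  then show ?thesis by (simp add: ldim_def I(3) log_nat_power)
qed

text \<open>
  Spans turn unions into sums, so this is \<open>kinser_fin_subgroups\<close> for the spans of the sets \<open>X i\<close>. Sets
  with index outside \<open>1..n\<close> need not lie in the ground set and are replaced by the empty set.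
\<close>

theorem binary_kinser:
  assumes "3 \<le> n"
  shows "(E, binary_indep v E) \<in> kinser_class n"
proof -
  let ?r = "matroid_rank (binary_indep v E)"
  have "kinser_inequality n ?r X" if X: "\<forall>i \<in> {1..n}. X i \<subseteq> E" for X
  proof -
    define V where "V i = subset_sums v (if i \<in> {1..n} then X i else {})" for i
    have V: "fin_subgroup (V i)" for i
      unfolding V_def using X by (intro fin_subgroup_subset_sums) auto
    have V1: "ldim (V i) = real (?r (X i))" if "i \<in> {1..n}" for i
      using X that by (simp add: V_def ldim_subset_sums)
    have V2: "ldim (V i + V j) = real (?r (X i \<union> X j))" if "i \<in> {1..n}" "j \<in> {1..n}" for i j
      using X that by (simp add: V_def ldim_subset_sums flip: subset_sums_Un)
    have V3: "ldim (V i + V j + V k) = real (?r (X i \<union> X j \<union> X k))"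
      if "i \<in> {1..n}" "j \<in> {1..n}" "k \<in> {1..n}" for i j k
      using X that by (simp add: V_def ldim_subset_sums flip: subset_sums_Un)
    have S2: "(\<Sum>i = 4..n. ldim (V (i - 1) + V i)) = (\<Sum>i = 4..n. real (?r (X (i - 1) \<union> X i)))"
      by (intro sum.cong V2 refl) auto
    have S3: "(\<Sum>i = 4..n. ldim (V 2 + V (i - 1) + V i))
        = (\<Sum>i = 4..n. real (?r (X 2 \<union> X (i - 1) \<union> X i)))"
      using assms by (intro sum.cong V3 refl) auto
    have "(\<Sum>i = 3..n. real (?r (X i))) + real (?r (X 1 \<union> X 2)) + real (?r (X 1 \<union> X 3 \<union> X n))
         + (\<Sum>i = 4..n. real (?r (X 2 \<union> X (i - 1) \<union> X i)))
       \<le> real (?r (X 1 \<union> X 3)) + real (?r (X 1 \<union> X n)) + (\<Sum>i = 3..n. real (?r (X 2 \<union> X i)))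
         + (\<Sum>i = 4..n. real (?r (X (i - 1) \<union> X i)))"
      using kinser_fin_subgroups[of V n, OF V assms] assms
      by (simp add: V1 V2 V3 S2 S3 del: One_nat_def)
    then show ?thesis unfolding kinser_inequality_def by (simp flip: of_nat_sum of_nat_add)
  qed
  then show ?thesis unfolding kinser_class_def using matroid_axioms by simp
qed

end

section \<open>Binary spikes\<close>

text \<open>
  Vectors are polynomials of degree below \<open>r\<close> over the two-element field, coefficients being
  coordinates. The leg \<open>i\<close> consists of the elements \<open>2 i\<close> and \<open>2 i + 1\<close>; the even one is a unit vector, the
  odd one is the unit vector plus the all-ones vector.
\<close>

definition spike_vector :: "nat \<Rightarrow> nat \<Rightarrow> bit poly" where
  "spike_vector r e = monom 1 (e div 2) + (if odd e then \<Sum>j<r. monom 1 j else 0)"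

definition spike :: "nat \<Rightarrow> nat set set" where
  "spike r = binary_indep (spike_vector r) {..<2 * r}"

text \<open>
  Each of these legs contributes one all-ones vector to the sum of \<open>Y\<close>, so the parity of their number decides
  whether the all-ones vector survives in the sum.
\<close>

definition tops :: "nat \<Rightarrow> nat set \<Rightarrow> nat set" where
  "tops r Y = {i. i < r \<and> 2 * i + 1 \<in> Y}"

text \<open>
  The sets with sum zero, coordinate by coordinate (\<open>sum_spike_vector_eq_0_iff\<close>). Such a set is either a union
  of an even number of legs, or it contains exactly one element of each leg, with an odd number of odd
  elements.
\<close>

definition spike_cycle :: "nat \<Rightarrow> nat set \<Rightarrow> bool" where
  "spike_cycle r Y \<longleftrightarrow> (\<forall>i<r. (2 * i \<in> Y \<longleftrightarrow> 2 * i + 1 \<notin> Y) \<longleftrightarrow> odd (card (tops r Y)))"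

interpretation spike: binary_vectors "spike_vector r" "{..<2 * r}" for r
proof
  show "g + g = 0" for g :: "bit poly"
  proof (rule poly_eqI)
    have "coeff (g + g) i = 2 * coeff g i" for i by (simp only: coeff_add mult_2)
    then show "coeff (g + g) i = coeff 0 i" for i by simp
  qed
qed simp

lemma matroid_spike: "matroid {..<2 * r} (spike r)"
  unfolding spike_def by (rule spike.matroid_axioms)

lemma sum_legs: "(\<Sum>e<2 * r. f e) = (\<Sum>i<r. f (2 * i) + f (2 * i + 1))"
  for f :: "nat \<Rightarrow> 'b::comm_monoid_add"
  by (induction r) (simp_all add: add.assoc)

lemma coeff_sum_spike_vector:
  assumes "Y \<subseteq> {..<2 * r}"
  shows "coeff (sum (spike_vector r) Y) i = (if i < r then
      of_bool (2 * i \<in> Y) + of_bool (2 * i + 1 \<in> Y) + of_nat (card (tops r Y)) else 0)"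
proof -
  have "coeff (sum (spike_vector r) Y) i = (\<Sum>e\<in>Y. coeff (spike_vector r e) i)"
    by (rule coeff_sum)
  also have "\<dots> = (\<Sum>e<2 * r. of_bool (e \<in> Y) * coeff (spike_vector r e) i)"
    using assms by (intro sum.mono_neutral_cong_left) auto
  also have "\<dots> = (\<Sum>j<r. of_bool (2 * j \<in> Y) * of_bool (j = i)
      + of_bool (2 * j + 1 \<in> Y) * (of_bool (j = i) + of_bool (i < r)))"
    unfolding sum_legs
    by (intro sum.cong refl) (simp add: spike_vector_def coeff_sum if_distrib cong: if_cong)
  also have "\<dots> = (\<Sum>j<r. if j = i then of_bool (2 * j \<in> Y) + of_bool (2 * j + 1 \<in> Y) else 0)
      + (\<Sum>j<r. of_bool (2 * j + 1 \<in> Y) * of_bool (i < r))"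
    unfolding sum.distrib[symmetric]
  proof (intro sum.cong refl)
    fix j
    show "of_bool (2 * j \<in> Y) * of_bool (j = i) + of_bool (2 * j + 1 \<in> Y) * (of_bool (j = i) + of_bool (i < r))
      = (if j = i then of_bool (2 * j \<in> Y) + of_bool (2 * j + 1 \<in> Y) else 0)
        + (of_bool (2 * j + 1 \<in> Y) * of_bool (i < r) :: bit)"
      by (cases "j = i") (simp_all only: simp_thms if_True if_False of_bool_eq distrib_left mult_1_right mult_zero_right add_0 add.assoc)
  qed
  also have "(\<Sum>j<r. of_bool (2 * j + 1 \<in> Y) * of_bool (i < r)) = (of_bool (i < r) * of_nat (card (tops r Y)) :: bit)"
  proof -
    have "(\<Sum>j<r. of_bool (2 * j + 1 \<in> Y)) = (of_nat (card (tops r Y)) :: bit)"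
      by (simp add: tops_def of_bool_def sum.If_cases Int_def)
    then show ?thesis by (cases "i < r") simp_all
  qed
  finally show ?thesis by auto
qed

lemma sum_spike_vector_eq_0_iff:
  assumes "Y \<subseteq> {..<2 * r}"
  shows "sum (spike_vector r) Y = 0 \<longleftrightarrow> spike_cycle r Y"
proof -
  have of_nat_bit: "of_nat k = (of_bool (odd k) :: bit)" for k
    by (induction k) auto
  have "sum (spike_vector r) Y = 0 \<longleftrightarrow> (\<forall>i<r. coeff (sum (spike_vector r) Y) i = 0)"
    using coeff_sum_spike_vector[OF assms] by (auto simp: poly_eq_iff)
  also have "\<dots> \<longleftrightarrow> spike_cycle r Y"
    unfolding spike_cycle_def coeff_sum_spike_vector[OF assms] of_nat_bit
    by (intro all_cong imp_cong refl) (auto simp: of_bool_def)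
  finally show ?thesis .
qed

lemma in_spike_iff: "I \<in> spike r \<longleftrightarrow> I \<subseteq> {..<2 * r} \<and> (\<forall>Y \<subseteq> I. spike_cycle r Y \<longrightarrow> Y = {})"
  unfolding spike_def binary_indep_def mem_Collect_eq
proof (rule conj_cong[OF refl])
  assume "I \<subseteq> {..<2 * r}"
  then have "sum (spike_vector r) Y = 0 \<longleftrightarrow> spike_cycle r Y" if "Y \<subseteq> I" for Y
    using that by (intro sum_spike_vector_eq_0_iff) auto
  then show "(\<forall>Y \<subseteq> I. sum (spike_vector r) Y = 0 \<longrightarrow> Y = {}) \<longleftrightarrow> (\<forall>Y \<subseteq> I. spike_cycle r Y \<longrightarrow> Y = {})"
    by simp
qed

lemma not_in_spike: "spike_cycle r Y \<Longrightarrow> Y \<noteq> {} \<Longrightarrow> Y \<subseteq> X \<Longrightarrow> X \<notin> spike r"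
  unfolding in_spike_iff by blast

text \<open>
  All subset sums lie in an \<open>r\<close>-dimensional space.
\<close>

lemma card_spike_le:
  assumes "I \<in> spike r"
  shows "card I \<le> r"
proof -
  let ?S = "subset_sums (spike_vector r) I"
  have I: "I \<subseteq> {..<2 * r}" using assms by (simp add: in_spike_iff)
  have zero: "coeff p i = 0" if p: "p \<in> ?S" and i: "\<not> i < r" for p i
  proof -
    obtain Y where "Y \<subseteq> I" "p = sum (spike_vector r) Y" using p by (auto simp: subset_sums_def)
    then show ?thesis using coeff_sum_spike_vector[of Y r i] I i by auto
  qed
  have "inj_on (\<lambda>p. {i. i < r \<and> coeff p i = 1}) ?S"
  proof (rule inj_onI)
    fix p q assume pq: "p \<in> ?S" "q \<in> ?S" and eq: "{i. i < r \<and> coeff p i = 1} = {i. i < r \<and> coeff q i = 1}"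
    have "coeff p i = coeff q i" for i
    proof (cases "i < r")
      case True
      then have "coeff p i = 1 \<longleftrightarrow> coeff q i = 1" using eq by blast
      then show ?thesis by (metis bit_not_one_iff)
    next
      case False
      then show ?thesis using zero pq by simp
    qed
    then show "p = q" by (rule poly_eqI)
  qed
  then have "card ?S \<le> card (Pow {..<r})"
    by (rule card_inj_on_le) auto
  moreover have "card ?S = 2 ^ card I"
    using assms by (intro spike.card_subset_sums_indep) (simp add: spike_def)
  ultimately show ?thesis by (simp add: card_Pow)
qed

section \<open>Transversals of the legs\<close>

definition transversal :: "nat \<Rightarrow> nat set \<Rightarrow> nat set" where
  "transversal r A = {e. e < 2 * r \<and> (odd e \<longleftrightarrow> e div 2 \<in> A)}"

lemma in_transversal_double [simp]:
  "2 * i \<in> transversal r A \<longleftrightarrow> i < r \<and> i \<notin> A"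
  "Suc (2 * i) \<in> transversal r A \<longleftrightarrow> i < r \<and> i \<in> A"
  by (auto simp: transversal_def)

lemma transversal_subset: "transversal r A \<subseteq> {..<2 * r}"
  by (auto simp: transversal_def)

lemma tops_transversal: "A \<subseteq> {..<r} \<Longrightarrow> tops r (transversal r A) = A"
  by (auto simp: tops_def)

lemma card_transversal_on:
  assumes "L \<subseteq> {..<r}"
  shows "card {e \<in> transversal r A. e div 2 \<in> L} = card L"
proof -
  have "bij_betw (\<lambda>e. e div 2) {e \<in> transversal r A. e div 2 \<in> L} L"
  proof (rule bij_betw_byWitness[where f' = "\<lambda>i. 2 * i + of_bool (i \<in> A)"])
    show "(\<lambda>i. 2 * i + of_bool (i \<in> A)) ` L \<subseteq> {e \<in> transversal r A. e div 2 \<in> L}"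
      using assms by (auto simp: of_bool_def)
  qed (auto simp: transversal_def of_bool_def elim!: evenE oddE)
  then show ?thesis by (rule bij_betw_same_card)
qed

lemma card_transversal: "card (transversal r A) = r"
proof -
  have "{e \<in> transversal r A. e div 2 \<in> {..<r}} = transversal r A" by (auto simp: transversal_def)
  then show ?thesis using card_transversal_on[of "{..<r}" r A] by simp
qed

lemma compl_transversal: "{..<2 * r} - transversal r A = transversal r ({..<r} - A)"
  by (auto simp: transversal_def)

lemma inj_on_transversal: "inj_on (transversal r) (Pow {..<r})"
  by (rule inj_on_inverseI[where g = "tops r"]) (simp add: tops_transversal)

lemma eq_transversalI:
  assumes "Y \<subseteq> {..<2 * r}" and "\<And>i. i < r \<Longrightarrow> 2 * i \<in> Y \<longleftrightarrow> 2 * i + 1 \<notin> Y"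
  shows "Y = transversal r (tops r Y)"
proof (rule set_eqI)
  fix e
  show "e \<in> Y \<longleftrightarrow> e \<in> transversal r (tops r Y)"
  proof (cases "e < 2 * r")
    case True
    then have "e div 2 < r" by simp
    then show ?thesis using assms(2)[of "e div 2"] True by (cases "even e") (auto simp: tops_def elim!: evenE oddE)
  next
    case False
    then show ?thesis using assms(1) transversal_subset by auto
  qed
qed

lemma spike_cycle_transversal: "A \<subseteq> {..<r} \<Longrightarrow> odd (card A) \<Longrightarrow> spike_cycle r (transversal r A)"
  unfolding spike_cycle_def by (auto simp: tops_transversal)

lemma transversal_notin_spike:
  assumes "A \<subseteq> {..<r}" "odd (card A)"
  shows "transversal r A \<notin> spike r"
proof (rule not_in_spike[OF spike_cycle_transversal[OF assms]])
  have "0 < r" using assms by (cases r) auto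
  then show "transversal r A \<noteq> {}" using card_transversal[of r A] by force
qed simp

lemma spike_cycle_two_legs:
  assumes "i < r" "j < r" "i \<noteq> j"
  shows "spike_cycle r {2 * i, 2 * i + 1, 2 * j, 2 * j + 1}"
proof -
  have "tops r {2 * i, 2 * i + 1, 2 * j, 2 * j + 1} = {i, j}"
    using assms by (auto simp: tops_def)
  moreover have "2 * l \<noteq> Suc (2 * k)" "Suc (2 * k) \<noteq> 2 * l" for k l :: nat by presburger+
  ultimately show ?thesis using assms unfolding spike_cycle_def by simp
qed

lemma same_leg:
  fixes x y :: nat
  assumes "x div 2 = y div 2" "x \<noteq> y"
  shows "x = 2 * (x div 2) \<and> y = 2 * (x div 2) + 1 \<or> y = 2 * (x div 2) \<and> x = 2 * (x div 2) + 1"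
  using assms by (cases "even x"; cases "even y") (auto elim!: evenE oddE)

lemma card_sym_diff_parity:
  assumes "finite A" "finite B"
  shows "even (card ((A - B) \<union> (B - A))) \<longleftrightarrow> (even (card A) \<longleftrightarrow> even (card B))"
proof -
  have "card A = card (A - B) + card (A \<inter> B)" "card B = card (B - A) + card (A \<inter> B)"
    using assms by (simp_all add: card_Diff_subset_Int Int_commute card_mono)
  moreover have "card ((A - B) \<union> (B - A)) = card (A - B) + card (B - A)"
    using assms by (intro card_Un_disjoint) auto
  ultimately show ?thesis by auto
qed

text \<open>
  A nonempty cycle in the exchanged set \<open>S\<close> is impossible. A union of an even number of legs does not
  fit, because \<open>S\<close> contains at most one full leg, that of \<open>e\<close>. An odd transversal would have to be
  all of \<open>S\<close>; but \<open>S\<close> either misses the leg of \<open>x\<close>, or \<open>e\<close> is the partner of \<open>x\<close> and \<open>S\<close> is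
  a transversal of even parity.
\<close>

lemma exchange_transversal:
  assumes A: "A \<subseteq> {..<r}" "odd (card A)"
    and e: "e \<in> {..<2 * r} - transversal r A" and x: "x \<in> transversal r A"
  shows "insert e (transversal r A - {x}) \<in> spike r" (is "?S \<in> _")
proof -
  have mem: "m \<in> ?S \<longleftrightarrow> m < 2 * r \<and> (if odd m \<longleftrightarrow> m div 2 \<in> A then m \<noteq> x else m = e)" for m
    using e by (auto simp: transversal_def)
  have ex: "e < 2 * r" "odd e \<longleftrightarrow> e div 2 \<notin> A" "x < 2 * r" "odd x \<longleftrightarrow> x div 2 \<in> A"
    using e x by (auto simp: transversal_def)
  have "Y = {}" if Y: "Y \<subseteq> ?S" and cyc: "spike_cycle r Y" for Y
  proof (cases "odd (card (tops r Y))")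
    case True
    then have one: "2 * i \<in> Y \<longleftrightarrow> 2 * i + 1 \<notin> Y" if "i < r" for i
      using cyc that by (auto simp: spike_cycle_def)
    have "Y = transversal r (tops r Y)"
      using Y mem one by (intro eq_transversalI) auto
    then have "card Y = r" using card_transversal[of r "tops r Y"] by simp
    moreover have "finite ?S" "card ?S \<le> r"
    proof -
      have "finite (transversal r A)" by (rule finite_subset[OF transversal_subset]) simp
      then show "finite ?S" "card ?S \<le> r"
        using card_transversal[of r A] x e by (auto simp: card.insert_remove card_gt_0_iff Suc_le_eq)
    qed
    ultimately have YS: "Y = ?S" using Y by (intro card_seteq) auto
    show ?thesis
    proof (cases "e div 2 = x div 2")
      case True
      let ?j = "x div 2"
      have "?S = transversal r ((A - {?j}) \<union> ({?j} - A))"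
      proof (rule set_eqI)
        fix m
        have "x \<noteq> e" using e x by blast
        show "m \<in> ?S \<longleftrightarrow> m \<in> transversal r ((A - {?j}) \<union> ({?j} - A))"
        proof (cases "m div 2 = ?j")
          case j: True
          then have "m = x \<or> m = e" using same_leg[of m x] same_leg[of e x] True \<open>x \<noteq> e\<close> by force
          then show ?thesis unfolding mem using ex True by (auto simp: transversal_def)
        next
          case False
          then have "m \<noteq> x" "m \<noteq> e" using True by auto
          then show ?thesis unfolding mem using False by (simp add: transversal_def)
        qed
      qed
      moreover have "((A - {?j}) \<union> ({?j} - A)) \<subseteq> {..<r}" using A ex by auto
      ultimately have "tops r Y = (A - {?j}) \<union> ({?j} - A)" using YS tops_transversal by metis
      then show ?thesis
        using \<open>odd (card (tops r Y))\<close> A card_sym_diff_parity[of A "{?j}"] finite_subset[OF A(1)] by simp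
    next
      case False
      have "x div 2 < r" using ex by simp
      then have "2 * (x div 2) \<in> ?S \<longleftrightarrow> 2 * (x div 2) + 1 \<notin> ?S" using one YS by blast
      then show ?thesis unfolding mem using ex False by (auto split: if_splits)
    qed
  next
    case False
    then have two: "2 * i \<in> Y \<longleftrightarrow> 2 * i + 1 \<in> Y" if "i < r" for i
      using cyc that by (auto simp: spike_cycle_def)
    let ?j = "e div 2"
    have only: "i = ?j" if "i < r" "2 * i + 1 \<in> Y" for i
    proof -
      have "2 * i \<in> Y" using that two by simp
      then have "2 * i \<in> ?S" "2 * i + 1 \<in> ?S" using that Y by (blast, blast)
      then show ?thesis unfolding mem by (auto split: if_splits)
    qed
    then have "tops r Y \<subseteq> {?j}" by (auto simp: tops_def)
    then have "tops r Y = {}" using False by (auto simp: subset_singleton_iff)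
    then have "2 * i + 1 \<notin> Y" "2 * i \<notin> Y" if "i < r" for i
      using that two by (auto simp: tops_def)
    moreover have "m = 2 * (m div 2) \<or> m = 2 * (m div 2) + 1" for m :: nat by presburger
    moreover have "m div 2 < r" if "m \<in> Y" for m
    proof -
      have "m < 2 * r" using that Y mem by blast
      then show ?thesis by simp
    qed
    ultimately show ?thesis by (metis equals0I)
  qed
  then show ?thesis unfolding in_spike_iff using mem by blast
qed

lemma circuit_hyperplane_transversal:
  assumes "A \<subseteq> {..<r}" "odd (card A)"
  shows "circuit_hyperplane {..<2 * r} (spike r) (transversal r A)"
proof -
  interpret matroid "{..<2 * r}" "spike r" by (rule matroid_spike)
  show ?thesis
  proof
    have "0 < r" using assms by (cases r) auto
    then have "transversal r A \<noteq> {..<2 * r}" using card_transversal[of r A] by force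
    then show "transversal r A \<subset> {..<2 * r}" using transversal_subset by blast
  qed (use assms exchange_transversal transversal_notin_spike card_spike_le card_transversal in auto)
qed

lemma odd_card_compl:
  fixes r :: nat
  assumes "even r" "A \<subseteq> {..<r}"
  shows "odd (card ({..<r} - A)) \<longleftrightarrow> odd (card A)"
proof -
  have "card ({..<r} - A) = r - card A" "card A \<le> r"
    using assms(2) card_mono[of "{..<r}" A] by (auto simp: card_Diff_subset finite_subset)
  then show ?thesis using assms(1) by simp
qed

text \<open>
  A nonempty cycle \<open>Y\<close> avoiding the basis \<open>B\<close> is impossible. If \<open>Y\<close> is an odd transversal, it is the whole
  complement of \<open>B\<close>, and \<open>B\<close> is a transversal of parity \<open>r\<close> minus an odd number, hence dependent; here
  \<open>r\<close> has to be even. If \<open>Y\<close> is a union of legs, there are at least two of them, and \<open>B\<close> lives on the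
  remaining \<open>r - 2\<close> legs. As an independent set contains at most one full leg, \<open>B\<close> has at most \<open>r - 1\<close>
  elements.
\<close>

lemma compl_base_spike:
  assumes "even r" and B: "B \<in> spike r" "card B = r"
  shows "{..<2 * r} - B \<in> spike r"
proof -
  have BE: "B \<subseteq> {..<2 * r}" and B0: "\<And>Y. Y \<subseteq> B \<Longrightarrow> spike_cycle r Y \<Longrightarrow> Y = {}"
    using B by (auto simp: in_spike_iff)
  have finB: "finite B" using BE by (rule finite_subset) simp
  have "Y = {}" if Y: "Y \<subseteq> {..<2 * r} - B" and cyc: "spike_cycle r Y" for Y
  proof (cases "odd (card (tops r Y))")
    case True
    then have one: "2 * i \<in> Y \<longleftrightarrow> 2 * i + 1 \<notin> Y" if "i < r" for i
      using cyc that by (auto simp: spike_cycle_def)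
    have YT: "Y = transversal r (tops r Y)"
      using Y one by (intro eq_transversalI) auto
    then have "card Y = r" using card_transversal[of r "tops r Y"] by simp
    moreover have "card ({..<2 * r} - B) = r" using BE B finB by (simp add: card_Diff_subset)
    ultimately have "Y = {..<2 * r} - B" using Y by (intro card_seteq) auto
    then have "B = {..<2 * r} - Y" using BE by blast
    then have BT: "B = transversal r ({..<r} - tops r Y)" using YT compl_transversal by metis
    have "tops r Y \<subseteq> {..<r}" by (auto simp: tops_def)
    then have "odd (card ({..<r} - tops r Y))" using True \<open>even r\<close> by (simp add: odd_card_compl)
    then have "B \<notin> spike r" unfolding BT by (intro transversal_notin_spike) auto
    then show ?thesis using B by blast
  next
    case False
    then have two: "2 * i \<in> Y \<longleftrightarrow> 2 * i + 1 \<in> Y" if "i < r" for i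
      using cyc that by (auto simp: spike_cycle_def)
    have disj: "e div 2 \<notin> tops r Y" if "e \<in> B" for e
    proof
      assume "e div 2 \<in> tops r Y"
      then have "2 * (e div 2) \<in> Y" "2 * (e div 2) + 1 \<in> Y" using two by (auto simp: tops_def)
      moreover have "e = 2 * (e div 2) \<or> e = 2 * (e div 2) + 1" by presburger
      ultimately show False using Y that by (metis DiffD2 subsetD)
    qed
    have fin: "finite (tops r Y)" by (simp add: tops_def)
    have sub: "tops r Y \<subseteq> {..<r}" by (auto simp: tops_def)
    \<comment> \<open>Dropping one element, from the full leg if there is one, leaves at most one element in each leg.\<close>
    have "\<exists>c. inj_on (\<lambda>e. e div 2) (B - {c})"
    proof (cases "\<exists>i<r. 2 * i \<in> B \<and> 2 * i + 1 \<in> B")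
      case True
      then obtain i where i: "i < r" "2 * i \<in> B" "2 * i + 1 \<in> B" by blast
      have "x = y" if xy: "x \<in> B - {2 * i}" "y \<in> B - {2 * i}" "x div 2 = y div 2" for x y
      proof (rule ccontr)
        assume "x \<noteq> y"
        let ?j = "x div 2"
        have j: "?j < r" using xy BE by auto
        note pair = same_leg[OF xy(3) \<open>x \<noteq> y\<close>]
        have full: "2 * ?j \<in> B" "2 * ?j + 1 \<in> B" using pair xy(1,2) by (metis DiffD1)+
        have "?j \<noteq> i" using pair xy(1,2) by blast
        then have "spike_cycle r {2 * i, 2 * i + 1, 2 * ?j, 2 * ?j + 1}"
          using i j by (intro spike_cycle_two_legs) auto
        then show False using B0[of "{2 * i, 2 * i + 1, 2 * ?j, 2 * ?j + 1}"] i full by blast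
      qed
      then have "inj_on (\<lambda>e. e div 2) (B - {2 * i})" by (intro inj_onI)
      then show ?thesis by blast
    next
      case False
      have "x = y" if xy: "x \<in> B" "y \<in> B" "x div 2 = y div 2" for x y
      proof (rule ccontr)
        assume "x \<noteq> y"
        have "x div 2 < r" using xy BE by auto
        moreover have "2 * (x div 2) \<in> B" "2 * (x div 2) + 1 \<in> B"
          using same_leg[OF xy(3) \<open>x \<noteq> y\<close>] xy(1,2) by metis+
        ultimately show False using False by blast
      qed
      \<comment> \<open>Without a full leg nothing has to be dropped, so a number outside the ground set is used.\<close>
      then have "inj_on (\<lambda>e. e div 2) (B - {2 * r})" by (intro inj_onI) auto
      then show ?thesis by blast
    qed
    then obtain c where "inj_on (\<lambda>e. e div 2) (B - {c})" by blast
    moreover have "(\<lambda>e. e div 2) ` (B - {c}) \<subseteq> {..<r} - tops r Y" using BE disj by auto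
    ultimately have "card (B - {c}) \<le> card ({..<r} - tops r Y)" by (rule card_inj_on_le) simp
    also have "\<dots> = r - card (tops r Y)" using sub fin by (simp add: card_Diff_subset)
    finally have "r \<le> r - card (tops r Y) + 1" using finB B by (simp add: card_Diff_singleton_if split: if_splits)
    moreover have "card (tops r Y) \<le> r" using card_mono[OF _ sub] by simp
    ultimately have "card (tops r Y) \<le> 1" by linarith
    moreover obtain k where "card (tops r Y) = 2 * k" using False by blast
    ultimately have "card (tops r Y) = 0" by simp
    then have "tops r Y = {}" using fin by simp
    then have "2 * i + 1 \<notin> Y" "2 * i \<notin> Y" if "i < r" for i
      using that two by (auto simp: tops_def)
    moreover have "m = 2 * (m div 2) \<or> m = 2 * (m div 2) + 1" for m :: nat by presburger
    moreover have "m div 2 < r" if "m \<in> Y" for m using that Y by auto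
    ultimately show ?thesis by (metis equals0I)
  qed
  then show ?thesis unfolding in_spike_iff by blast
qed

lemma dual_spike:
  assumes "even r" "A \<subseteq> {..<r}" "odd (card A)"
  shows "dual_indep {..<2 * r} (spike r) = spike r"
    and "dual_indep {..<2 * r} (insert (transversal r A) (spike r)) = insert (transversal r ({..<r} - A)) (spike r)"
proof -
  interpret C: circuit_hyperplane "{..<2 * r}" "spike r" "transversal r A"
    using assms by (intro circuit_hyperplane_transversal)
  have odd': "odd (card ({..<r} - A))" using assms by (simp add: odd_card_compl)
  interpret D: circuit_hyperplane "{..<2 * r}" "spike r" "transversal r ({..<r} - A)"
    using odd' by (intro circuit_hyperplane_transversal) auto
  have 1: "{..<2 * r} - B \<in> spike r" if "B \<in> spike r" "card B = card (transversal r A)" for B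
    using that compl_base_spike[OF assms(1)] by (simp add: card_transversal)
  have 2: "card {..<2 * r} = 2 * card (transversal r A)" by (simp add: card_transversal)
  have 3: "J \<in> spike r" if "J \<subset> {..<2 * r} - transversal r A" for J
    using that D.psubset_indep by (simp add: compl_transversal)
  show "dual_indep {..<2 * r} (spike r) = spike r"
    using C.dual_indep_relaxation(1)[OF 1 2 3] by simp
  show "dual_indep {..<2 * r} (insert (transversal r A) (spike r)) = insert (transversal r ({..<r} - A)) (spike r)"
    using C.dual_indep_relaxation(2)[OF 1 2 3] by (simp add: compl_transversal)
qed

lemma spike_kinser: "3 \<le> n \<Longrightarrow> ({..<2 * r}, spike r) \<in> kinser_class n"
  unfolding spike_def by (rule spike.binary_kinser)

lemma card_odd_subsets:
  assumes "0 < r"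
  shows "card {A. A \<subseteq> {..<r} \<and> odd (card A)} = 2 ^ (r - 1)"
proof -
  let ?O = "{A. A \<subseteq> {..<r} \<and> odd (card A)}" and ?E = "{A. A \<subseteq> {..<r} \<and> even (card A)}"
  have "card ?E = card ?O" using card_subsupersets_even_odd[of "{..<r}" "{}"] assms by auto
  moreover have "card (?E \<union> ?O) = card ?E + card ?O"
    by (intro card_Un_disjoint) (auto simp: finite_subset[OF _ finite_Pow_iff[THEN iffD2]])
  moreover have "?E \<union> ?O = Pow {..<r}" by auto
  ultimately have "2 * card ?O = 2 ^ r" by (simp add: card_Pow)
  then show ?thesis using assms by (cases r) auto
qed

section \<open>Relaxed spikes violate the Kinser inequalities\<close>

text \<open>
  If \<open>X 4 = X 5 = \<dots> = X n\<close>, the terms of the sums with index above 4 are the same on both sides and cancel, leaving the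
  inequality for \<open>n = 4\<close>, which is Ingleton's inequality.
\<close>

lemma kinser_inequality_const_tail:
  assumes n: "4 \<le> n" and tail: "\<And>i. 4 \<le> i \<Longrightarrow> X i = X 4"
  shows "kinser_inequality n r X \<longleftrightarrow>
    r (X 3) + r (X 4) + r (X 1 \<union> X 2) + r (X 1 \<union> X 3 \<union> X 4) + r (X 2 \<union> X 3 \<union> X 4)
    \<le> r (X 1 \<union> X 3) + r (X 1 \<union> X 4) + r (X 2 \<union> X 3) + r (X 2 \<union> X 4) + r (X 3 \<union> X 4)"
proof -
  have split3: "(\<Sum>i = 3..n. f i) = f 3 + f 4 + (\<Sum>i = 5..n. f i)" for f :: "nat \<Rightarrow> nat"
    using n by (simp add: sum.atLeast_Suc_atMost)
  have split4: "(\<Sum>i = 4..n. f i) = f 4 + (\<Sum>i = 5..n. f i)" for f :: "nat \<Rightarrow> nat"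
    using n by (simp add: sum.atLeast_Suc_atMost)
  have c: "(\<Sum>i = 5..n. f (X (i - 1)) (X i)) = (\<Sum>i = 5..n. f (X 4) (X 4))" for f :: "_ \<Rightarrow> _ \<Rightarrow> nat"
  proof (intro sum.cong refl)
    fix i assume "i \<in> {5..n}"
    then have i: "4 \<le> i - 1" "4 \<le> i" by auto
    from tail[OF i(1)] tail[OF i(2)]
    show "f (X (i - 1)) (X i) = f (X 4) (X 4)" by simp
  qed
  show ?thesis
    unfolding kinser_inequality_def split3 split4
      c[of "\<lambda>_ Y. r Y"] c[of "\<lambda>_ Y. r (X 2 \<union> Y)"] c[of "\<lambda>Z Y. r (X 2 \<union> Z \<union> Y)"] c[of "\<lambda>Z Y. r (Z \<union> Y)"]
    using tail[of n] n by (simp add: Un_assoc add.assoc)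
qed

text \<open>
  The relaxed transversal \<open>T\<close> is cut, on the legs 0 to 3, into its elements on the legs 0 and 1 and those on the
  legs 2 and 3; \<open>X1\<close> and \<open>X2\<close> are these two pairs and \<open>X3\<close> and \<open>X4\<close> are the partner pairs on the same
  legs. All four sets also contain the elements of \<open>T\<close> on the legs from 4 on, which amounts to contracting
  these elements. Changing two or four elements of \<open>T\<close> to their partners keeps the parity, so
  \<open>X2 \<union> X3\<close>, \<open>X1 \<union> X4\<close> and \<open>X3 \<union> X4\<close> are other dependent transversals (given by \<open>A1\<close>, \<open>A2\<close> and \<open>A3\<close>),
  while \<open>X1 \<union> X3\<close> and \<open>X2 \<union> X4\<close> each contain two full legs. These five sets have rank at most \<open>r - 1\<close>, so
  the right-hand side of Ingleton's inequality is at most \<open>5 r - 5\<close>. On the left, \<open>X1 \<union> X2 = T\<close> has rank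
  \<open>r\<close> because of the relaxation, and the total is at least \<open>3 r + 2 (r - 2) = 5 r - 4\<close>.
\<close>

lemma relaxed_spike_violates_kinser:
  assumes A: "A \<subseteq> {..<r}" "odd (card A)" and r: "4 \<le> r" and n: "4 \<le> n"
  shows "({..<2 * r}, insert (transversal r A) (spike r)) \<notin> kinser_class n"
proof -
  let ?T = "transversal r A"
  interpret C: circuit_hyperplane "{..<2 * r}" "spike r" ?T
    using A by (rule circuit_hyperplane_transversal)
  interpret R: matroid "{..<2 * r}" "insert ?T (spike r)" by (rule C.matroid_relaxation)
  let ?R = "matroid_rank (insert ?T (spike r))"
  define A1 where "A1 = (A - {0, 1}) \<union> ({0, 1} - A)"
  define A2 where "A2 = (A - {2, 3}) \<union> ({2, 3} - A)"
  define A3 where "A3 = (A - {0, 1, 2, 3}) \<union> ({0, 1, 2, 3} - A)"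
  have fA: "finite A" using A(1) by (rule finite_subset) simp
  have sub: "A1 \<subseteq> {..<r}" "A2 \<subseteq> {..<r}" "A3 \<subseteq> {..<r}"
    using A(1) r by (auto simp: A1_def A2_def A3_def)
  have odds: "odd (card A1)" "odd (card A2)" "odd (card A3)"
    using A(2) fA by (simp_all add: A1_def A2_def A3_def card_sym_diff_parity)
  define X1 where "X1 = {e \<in> ?T. e < 4 \<or> 8 \<le> e}"
  define X2 where "X2 = {e \<in> ?T. 4 \<le> e}"
  define X3 where "X3 = {e \<in> transversal r A1. e < 4 \<or> 8 \<le> e}"
  define X4 where "X4 = {e \<in> transversal r A2. 4 \<le> e}"
  have div: "e div 2 = 0 \<or> e div 2 = 1 \<longleftrightarrow> e < 4" "e div 2 = 2 \<or> e div 2 = 3 \<longleftrightarrow> 4 \<le> e \<and> e < 8" for e :: nat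
    by presburger+
  have T1: "e \<in> transversal r A1 \<longleftrightarrow> e < 2 * r \<and> (e \<in> ?T \<longleftrightarrow> \<not> e < 4)" for e
    using div(1)[of e] by (auto simp: transversal_def A1_def)
  have T2: "e \<in> transversal r A2 \<longleftrightarrow> e < 2 * r \<and> (e \<in> ?T \<longleftrightarrow> \<not> (4 \<le> e \<and> e < 8))" for e
    using div(2)[of e] by (auto simp: transversal_def A2_def)
  have T3: "e \<in> transversal r A3 \<longleftrightarrow> e < 2 * r \<and> (e \<in> ?T \<longleftrightarrow> \<not> e < 8)" for e
    using div[of e] by (auto simp: transversal_def A3_def)
  have T: "e < 2 * r" "e div 2 < r" if "e \<in> ?T" for e
    using that by (auto simp: transversal_def)
  note X_defs = X1_def X2_def X3_def X4_def
  have E: "X1 \<subseteq> {..<2 * r}" "X2 \<subseteq> {..<2 * r}" "X3 \<subseteq> {..<2 * r}" "X4 \<subseteq> {..<2 * r}"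
    unfolding X_defs by (auto simp: transversal_def)
  have U12: "X1 \<union> X2 = ?T" unfolding X_defs by auto
  have U23: "X2 \<union> X3 = transversal r A1" unfolding X_defs by (auto simp: T1 dest: T)
  have U14: "X1 \<union> X4 = transversal r A2" unfolding X_defs by (auto simp: T2 dest: T)
  have U34: "X3 \<union> X4 = transversal r A3" unfolding X_defs by (auto simp: T1 T2 T3 dest: T)
  have U13: "X1 \<union> X3 = {..<4} \<union> {e \<in> ?T. e div 2 \<in> {4..<r}}"
    unfolding X_defs using r by (auto simp: T1 dest: T)
  have U24: "X2 \<union> X4 = {4..<8} \<union> {e \<in> ?T. e div 2 \<in> {4..<r}}"
    unfolding X_defs using r by (auto simp: T2 dest: T)
  have rest: "card {e \<in> ?T. e div 2 \<in> {4..<r}} = r - 4"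
    by (subst card_transversal_on) (auto intro: finite_subset[OF transversal_subset[of r A]])
  have dep: "?R X \<le> r - 1" if "X \<subseteq> {..<2 * r}" "X \<notin> spike r" "X \<noteq> ?T" "card X \<le> r" for X
  proof (rule R.rank_le)
    fix I assume I: "I \<in> insert ?T (spike r)" "I \<subseteq> X"
    have "I \<noteq> X" using I that by blast
    moreover have "finite X" using that(1) by (rule finite_subset) simp
    ultimately have "card I < card X" using I(2) by (intro psubset_card_mono) auto
    then show "card I \<le> r - 1" using that(4) by simp
  qed
  have tr_dep: "?R (transversal r B) \<le> r - 1" if "B \<subseteq> {..<r}" "odd (card B)" "transversal r B \<noteq> ?T" for B
    using that by (intro dep transversal_notin_spike transversal_subset) (simp_all add: card_transversal)
  have neq: "B = A" if "transversal r B = ?T" "B \<subseteq> {..<r}" for B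
    using that A(1) tops_transversal by metis
  have "0 \<in> A1 \<longleftrightarrow> 0 \<notin> A" "2 \<in> A2 \<longleftrightarrow> 2 \<notin> A" "0 \<in> A3 \<longleftrightarrow> 0 \<notin> A"
    by (simp_all add: A1_def A2_def A3_def)
  then have "transversal r A1 \<noteq> ?T" "transversal r A2 \<noteq> ?T" "transversal r A3 \<noteq> ?T"
    using neq[of A1] neq[of A2] neq[of A3] sub by blast+
  then have hi: "?R (X2 \<union> X3) \<le> r - 1" "?R (X1 \<union> X4) \<le> r - 1" "?R (X3 \<union> X4) \<le> r - 1"
    unfolding U23 U14 U34 using sub odds by - (rule tr_dep; assumption)+
  have hi13: "?R (X1 \<union> X3) \<le> r - 1"
  proof (rule dep)
    have "spike_cycle r {2 * 0, 2 * 0 + 1, 2 * 1, 2 * 1 + 1}"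
      using r by (intro spike_cycle_two_legs) auto
    then show "X1 \<union> X3 \<notin> spike r" unfolding U13 by (rule not_in_spike) auto
    have "{0, 1} \<subseteq> X1 \<union> X3" unfolding U13 by auto
    moreover have "\<not> {0, 1} \<subseteq> ?T" by (auto simp: transversal_def)
    ultimately show "X1 \<union> X3 \<noteq> ?T" by blast
    show "card (X1 \<union> X3) \<le> r"
      unfolding U13 using card_Un_le[of "{..<4}" "{e \<in> ?T. e div 2 \<in> {4..<r}}"] rest r by simp
  qed (use E in auto)
  have hi24: "?R (X2 \<union> X4) \<le> r - 1"
  proof (rule dep)
    have "spike_cycle r {2 * 2, 2 * 2 + 1, 2 * 3, 2 * 3 + 1}"
      using r by (intro spike_cycle_two_legs) auto
    then show "X2 \<union> X4 \<notin> spike r" unfolding U24 by (rule not_in_spike) auto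
    have "{4, 5} \<subseteq> X2 \<union> X4" unfolding U24 by auto
    moreover have "\<not> {4, 5} \<subseteq> ?T" by (auto simp: transversal_def)
    ultimately show "X2 \<union> X4 \<noteq> ?T" by blast
    show "card (X2 \<union> X4) \<le> r"
      unfolding U24 using card_Un_le[of "{4..<8}" "{e \<in> ?T. e div 2 \<in> {4..<r}}"] rest r by simp
  qed (use E in auto)
  have lo12: "r \<le> ?R (X1 \<union> X2)"
    unfolding U12 using R.card_le_rank[of ?T ?T] by (simp add: card_transversal)
  interpret C1: circuit_hyperplane "{..<2 * r}" "spike r" "transversal r A1"
    using sub odds by (intro circuit_hyperplane_transversal)
  interpret C2: circuit_hyperplane "{..<2 * r}" "spike r" "transversal r A2"
    using sub odds by (intro circuit_hyperplane_transversal)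
  interpret C3: circuit_hyperplane "{..<2 * r}" "spike r" "transversal r A3"
    using sub odds by (intro circuit_hyperplane_transversal)
  have leg: "\<exists>e. e div 2 = i \<and> e \<in> transversal r B" if "i < r" for i B
    using that by (intro exI[of _ "2 * i + of_bool (i \<in> B)"]) (auto simp: of_bool_def)
  have lo3: "r - 2 \<le> ?R X3"
  proof -
    have X3: "X3 = {e \<in> transversal r A1. e div 2 \<in> {0, 1} \<union> {4..<r}}"
      unfolding X_defs by (auto simp: transversal_def)
    have "card X3 = card ({0, 1} \<union> {4..<r})" unfolding X3 using r by (intro card_transversal_on) auto
    also have "\<dots> = r - 2" using r by (subst card_Un_disjoint) auto
    finally have card: "card X3 = r - 2" .
    obtain e where "e div 2 = 2" "e \<in> transversal r A1" using leg[of 2] r by auto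
    then have "e \<notin> X3" "e \<in> transversal r A1" unfolding X3 by simp_all
    then have "X3 \<subset> transversal r A1" unfolding X3 by blast
    then show ?thesis using R.card_le_rank[of X3 X3] C1.psubset_indep[of X3] card by simp
  qed
  have lo4: "r - 2 \<le> ?R X4"
  proof -
    have X4: "X4 = {e \<in> transversal r A2. e div 2 \<in> {2..<r}}"
      unfolding X_defs by (auto simp: transversal_def)
    have card: "card X4 = r - 2" unfolding X4 by (subst card_transversal_on) auto
    obtain e where "e div 2 = 0" "e \<in> transversal r A2" using leg[of 0] r by auto
    then have "e \<notin> X4" "e \<in> transversal r A2" unfolding X4 by simp_all
    then have "X4 \<subset> transversal r A2" unfolding X4 by blast
    then show ?thesis using R.card_le_rank[of X4 X4] C2.psubset_indep[of X4] card by simp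
  qed
  have lo: "r \<le> ?R X" if X: "X3 \<union> X4 \<subseteq> X" and e: "e \<in> X" "e \<in> {..<2 * r} - transversal r A3" for X e
  proof -
    obtain x where x: "x \<in> transversal r A3" using C3.H_nonempty by blast
    have "insert e (transversal r A3 - {x}) \<subseteq> X" using X e unfolding U34 by blast
    then show ?thesis
      using R.card_le_rank[of _ X] C3.exchange[OF e(2) x] C3.card_exchange[OF e(2) x]
      by (metis card_transversal insertCI)
  qed
  have lo134: "r \<le> ?R (X1 \<union> X3 \<union> X4)"
  proof -
    obtain e where e: "e div 2 = 0" "e \<in> ?T" using leg[of 0] r by auto
    then have "e < 4" by simp
    then show ?thesis using e T[of e] by (intro lo[of _ e]) (auto simp: X1_def T3)
  qed
  have lo234: "r \<le> ?R (X2 \<union> X3 \<union> X4)"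
  proof -
    obtain e where e: "e div 2 = 2" "e \<in> ?T" using leg[of 2] r by auto
    then have "4 \<le> e \<and> e < 8" using div(2)[of e] by simp
    then show ?thesis using e T[of e] by (intro lo[of _ e]) (auto simp: X2_def T3)
  qed
  define X where "X i = (if i = 1 then X1 else if i = 2 then X2 else if i = 3 then X3 else X4)" for i :: nat
  have "\<not> kinser_inequality n ?R X"
  proof
    assume "kinser_inequality n ?R X"
    then have "?R X3 + ?R X4 + ?R (X1 \<union> X2) + ?R (X1 \<union> X3 \<union> X4) + ?R (X2 \<union> X3 \<union> X4)
      \<le> ?R (X1 \<union> X3) + ?R (X1 \<union> X4) + ?R (X2 \<union> X3) + ?R (X2 \<union> X4) + ?R (X3 \<union> X4)"
      using n by (simp add: kinser_inequality_const_tail X_def)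
    then show False using lo3 lo4 lo12 lo134 lo234 hi hi13 hi24 r by linarith
  qed
  moreover have "\<forall>i \<in> {1..n}. X i \<subseteq> {..<2 * r}" using E by (simp add: X_def)
  ultimately show ?thesis unfolding kinser_class_def by blast
qed

section \<open>Machines cannot see an unqueried relaxation\<close>

lemma machine_run_Suc: "machine_run M es f (Suc t) = machine_step M es f (machine_run M es f t)"
  by (simp add: machine_run_def)

lemma machine_run_halted:
  assumes "halted M (machine_run M es f t)" "t \<le> u"
  shows "machine_run M es f u = machine_run M es f t"
  using assms(2)
proof (induction u rule: dec_induct)
  case (step u)
  then show ?case using assms(1) by (simp add: machine_run_Suc machine_step_def)
qed simp

lemma halting_state_unique:
  assumes "fst (machine_run M es f t) \<in> {accept_state M, reject_state M}"
    and "fst (machine_run M es f u) \<in> {accept_state M, reject_state M}"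
  shows "fst (machine_run M es f t) = fst (machine_run M es f u)"
  using machine_run_halted[of M es f t u] machine_run_halted[of M es f u t] assms
  by (cases "t \<le> u") (simp_all add: halted_def)

abbreviation query_set :: "oracle_machine \<Rightarrow> 'a list \<Rightarrow> ('a set \<Rightarrow> nat) \<Rightarrow> nat \<Rightarrow> 'a set" where
  "query_set M es f t \<equiv> queried_set es (snd (machine_run M es f t) ! 1)"

lemma query_set_subset: "query_set M es f t \<subseteq> set es"
  by (cases "snd (machine_run M es f t) ! 1") auto

lemma machine_run_cong:
  assumes "\<And>u. u < t \<Longrightarrow> f (query_set M es f u) = g (query_set M es f u)"
  shows "machine_run M es g t = machine_run M es f t"
  using assms
proof (induction t)
  case 0
  then show ?case by (simp add: machine_run_def)
next
  case (Suc t)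
  then have "machine_run M es g t = machine_run M es f t" by simp
  then show ?case using Suc.prems[of t] by (simp add: machine_run_Suc machine_step_def)
qed

text \<open>
  The adversary argument: on \<open>(E, \<I>)\<close> the machine halts before it can have queried all of \<open>\<H>\<close>. For
  an unqueried \<open>H\<close>, the relaxation at \<open>H\<close> gives the same answers to all queries made, hence the same
  run and the same verdict, although \<open>P\<close> holds for only one of the two matroids.
\<close>

theorem no_polynomial_time_test:
  assumes wf: "wf_oracle_machine M" and poly: "polynomial_time M" and tests: "tests M P"
    and hard: "\<And>p :: nat poly. \<exists>E \<I> \<H>. matroid E \<I> \<and> P E \<I> \<and> poly p (card E) < card \<H> \<and>
      (\<forall>H \<in> \<H>. circuit_hyperplane E \<I> H \<and> \<not> P E (insert H \<I>))"
  shows False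
proof -
  obtain p :: "nat poly" where p: "\<And>(E :: nat set) \<I> es. matroid E \<I> \<Longrightarrow> distinct es \<Longrightarrow> set es = E \<Longrightarrow>
      \<exists>t \<le> poly p (card E). halted M (machine_run M es (matroid_rank \<I>) t)"
    using poly unfolding polynomial_time_def by blast
  obtain E \<I> \<H> where mat: "matroid E \<I>" and PE: "P E \<I>" and many: "poly p (card E) < card \<H>"
    and relax: "\<And>H. H \<in> \<H> \<Longrightarrow> circuit_hyperplane E \<I> H" "\<And>H. H \<in> \<H> \<Longrightarrow> \<not> P E (insert H \<I>)"
    using hard[of p] by blast
  interpret matroid E \<I> by (rule mat)
  obtain es where es: "distinct es" "set es = E"
    using finite_distinct_list[OF finite_ground] by blast
  let ?run = "machine_run M es"
  let ?f = "matroid_rank \<I>"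
  obtain t where t: "t \<le> poly p (card E)" "halted M (?run ?f t)" using p[OF mat es] by blast
  obtain t' where "fst (?run ?f t') = accept_state M"
    using tests mat es PE unfolding tests_def by metis
  then have acc: "fst (?run ?f t) = accept_state M"
    using halting_state_unique[of M es ?f t t'] t(2) by (simp add: halted_def)
  have "card (query_set M es ?f ` {..<t}) \<le> t"
    using card_image_le[of "{..<t}" "query_set M es ?f"] by simp
  then have "\<not> \<H> \<subseteq> query_set M es ?f ` {..<t}"
    using card_mono[of "query_set M es ?f ` {..<t}" \<H>] t(1) many by auto
  then obtain H where H: "H \<in> \<H>" "H \<notin> query_set M es ?f ` {..<t}" by blast
  interpret C: circuit_hyperplane E \<I> H using H(1) by (rule relax(1))
  let ?g = "matroid_rank (insert H \<I>)"
  have "?run ?g t = ?run ?f t"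
  proof (rule machine_run_cong)
    fix u assume "u < t"
    then have "query_set M es ?f u \<noteq> H" using H(2) by blast
    then show "?f (query_set M es ?f u) = ?g (query_set M es ?f u)"
      using C.rank_relaxation query_set_subset es(2) by metis
  qed
  moreover obtain u where "fst (?run ?g u) = reject_state M"
    using tests C.matroid_relaxation es relax(2)[OF H(1)] unfolding tests_def by metis
  ultimately have "accept_state M = reject_state M"
    using halting_state_unique[of M es ?g t u] acc by simp
  then show False using wf by (simp add: wf_oracle_machine_def)
qed

section \<open>Exponentially many circuit-hyperplanes\<close>

lemma poly_nat_le_power: "\<exists>c k. \<forall>m \<ge> 1. poly p m \<le> c * m ^ k" for p :: "nat poly"
proof (induction p)
  case 0
  then show ?case by (auto intro: exI[of _ 0])
next
  case (pCons a p)
  then obtain c k where ck: "\<And>m. 1 \<le> m \<Longrightarrow> poly p m \<le> c * m ^ k" by blast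
  have "poly (pCons a p) m \<le> (a + c) * m ^ Suc k" if "1 \<le> m" for m
  proof -
    have "poly (pCons a p) m = a * 1 + m * poly p m" by simp
    also have "\<dots> \<le> a * m ^ Suc k + m * (c * m ^ k)"
      using that ck[OF that] by (intro add_mono mult_le_mono2 one_le_power)
    also have "\<dots> = (a + c) * m ^ Suc k" by (simp add: algebra_simps)
    finally show ?thesis .
  qed
  then show ?case by blast
qed

lemma exponential_beats_poly:
  fixes p :: "nat poly"
  shows "\<exists>s\<ge>2. poly p (4 * s) < 2 ^ (2 * s - 1)"
proof -
  obtain c k where ck: "\<And>m. 1 \<le> m \<Longrightarrow> poly p m \<le> c * m ^ k" using poly_nat_le_power by blast
  \<comment> \<open>For \<open>s = 4 ^ m\<close> the bound \<open>c (4 s) ^ k\<close> is below \<open>2 ^ (c + (2 m + 2) k)\<close>. As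
    \<open>c + k < m\<close>, the exponent is below \<open>2 (m + 1)\<^sup>2\<close>, whereas \<open>s = (2 ^ m)\<^sup>2 \<ge> (m + 1)\<^sup>2\<close>.\<close>
  define m where "m = c + k + 1"
  define s :: nat where "s = 4 ^ m"
  have "m + 1 \<le> 2 ^ m" unfolding Suc_eq_plus1[symmetric] by (intro Suc_leI less_exp)
  then have "(m + 1) ^ 2 \<le> (2 ^ m) ^ 2" by (rule power_mono) simp
  also have "(2 ^ m) ^ 2 = s" by (simp add: s_def power2_eq_square flip: power_mult_distrib)
  finally have s: "(m + 1) ^ 2 \<le> s" .
  have "c + (2 * m + 2) * k + 1 \<le> 2 * (m + 1) ^ 2"
    by (simp add: m_def power2_eq_square algebra_simps)
  then have e: "c + (2 * m + 2) * k \<le> 2 * s - 1" using s by simp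
  have four: "4 * s = 2 ^ (2 * m + 2)" by (simp add: s_def power_mult)
  have "poly p (4 * s) \<le> c * (4 * s) ^ k" using ck[of "4 * s"] by (simp add: s_def)
  also have "(4 * s) ^ k = 2 ^ ((2 * m + 2) * k)" unfolding four by (simp only: power_mult)
  also have "c * 2 ^ ((2 * m + 2) * k) < 2 ^ c * 2 ^ ((2 * m + 2) * k)" by simp
  also have "\<dots> \<le> 2 ^ (2 * s - 1)" unfolding power_add[symmetric] using e by (rule power_increasing) simp
  finally have "poly p (4 * s) < 2 ^ (2 * s - 1)" .
  moreover have "2 \<le> s" using s by (simp add: m_def power2_eq_square)
  ultimately show ?thesis by blast
qed

lemma even_rank_spike_large:
  fixes p :: "nat poly"
  obtains r where "even r" "4 \<le> r" "poly p (2 * r) < 2 ^ (r - 1)"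
proof -
  obtain s where "2 \<le> s" "poly p (4 * s) < 2 ^ (2 * s - 1)" using exponential_beats_poly by blast
  then show ?thesis by (intro that[of "2 * s"]) auto
qed

section \<open>No polynomial-time test\<close>

theorem theorem6p3:
  fixes n :: nat
  assumes "4 \<le> n"
  shows "\<not> (\<exists>M. wf_oracle_machine M \<and> polynomial_time M \<and>
               tests M (\<lambda>E \<I>. (E, \<I>) \<in> kinser_class n)) \<and>
         \<not> (\<exists>M. wf_oracle_machine M \<and> polynomial_time M \<and>
               tests M (\<lambda>E \<I>. (E, dual_indep E \<I>) \<in> kinser_class n))"
proof -
  \<comment> \<open>The two claims differ only in the property, which must hold for spikes of even rank at least 4 and
    fail for their relaxations; an even rank makes the spike its own dual.\<close>
  have hard: "\<exists>E \<I> \<H>. matroid E \<I> \<and> Q E \<I> \<and> poly p (card E) < card \<H> \<and>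
      (\<forall>H \<in> \<H>. circuit_hyperplane E \<I> H \<and> \<not> Q E (insert H \<I>))"
    if Q: "\<And>r A. even r \<Longrightarrow> 4 \<le> r \<Longrightarrow> A \<subseteq> {..<r} \<Longrightarrow> odd (card A) \<Longrightarrow>
      Q {..<2 * r} (spike r) \<and> \<not> Q {..<2 * r} (insert (transversal r A) (spike r))"
    for Q :: "nat set \<Rightarrow> nat set set \<Rightarrow> bool" and p :: "nat poly"
  proof -
    obtain r where r: "even r" "4 \<le> r" "poly p (2 * r) < 2 ^ (r - 1)" by (rule even_rank_spike_large)
    let ?O = "{A. A \<subseteq> {..<r} \<and> odd (card A)}"
    have "card (transversal r ` ?O) = 2 ^ (r - 1)"
      using card_odd_subsets[of r] inj_on_subset[OF inj_on_transversal, of ?O r] r(2)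
      by (subst card_image) auto
    moreover have "{0} \<in> ?O" using r(2) by simp
    then have "Q {..<2 * r} (spike r)" using Q[OF r(1,2), of "{0}"] by simp
    ultimately show ?thesis
      using r Q[OF r(1,2)] matroid_spike circuit_hyperplane_transversal
      by (intro exI[of _ "{..<2 * r}"] exI[of _ "spike r"] exI[of _ "transversal r ` ?O"]) auto
  qed
  have no_test: "\<not> (\<exists>M. wf_oracle_machine M \<and> polynomial_time M \<and> tests M Q)"
    if "\<And>r A. even r \<Longrightarrow> 4 \<le> r \<Longrightarrow> A \<subseteq> {..<r} \<Longrightarrow> odd (card A) \<Longrightarrow>
      Q {..<2 * r} (spike r) \<and> \<not> Q {..<2 * r} (insert (transversal r A) (spike r))" for Q
    using no_polynomial_time_test[OF _ _ _ hard[OF that]] by blast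
  show ?thesis
  proof
    show "\<not> (\<exists>M. wf_oracle_machine M \<and> polynomial_time M \<and> tests M (\<lambda>E \<I>. (E, \<I>) \<in> kinser_class n))"
      using assms by (intro no_test conjI spike_kinser relaxed_spike_violates_kinser) auto
    show "\<not> (\<exists>M. wf_oracle_machine M \<and> polynomial_time M \<and>
               tests M (\<lambda>E \<I>. (E, dual_indep E \<I>) \<in> kinser_class n))"
    proof (rule no_test)
      fix r :: nat and A :: "nat set"
      assume rA: "even r" "4 \<le> r" "A \<subseteq> {..<r}" "odd (card A)"
      show "({..<2 * r}, dual_indep {..<2 * r} (spike r)) \<in> kinser_class n \<and>
        ({..<2 * r}, dual_indep {..<2 * r} (insert (transversal r A) (spike r))) \<notin> kinser_class n"
        unfolding dual_spike[OF rA(1,3,4)]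
        using assms rA odd_card_compl[OF rA(1,3)]
        by (intro conjI spike_kinser relaxed_spike_violates_kinser) auto
    qed
  qed
qed

end
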